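(* Let $\mathfrak{g}=\mathfrak{sl}(r+1,\mathbb{C})$ and consider its fundamental representation $V(\omega_1)$. Set $\omega_0=\omega_{r+1}=0$, and extend $q=(q_1,\ldots,q_r)$ by $q_0=q_{r+1}=1$. Then for every $N\in\mathbb{N}$ $$\operatorname{Char}S^N V(\omega_1)(ix)=\sum_{i=0}^r q_i^{-N}q_{i+1}^{N}\,A_{-\omega_i+\omega_{i+1},1}(q)$$ with rational functions $A_{-\omega_i+\omega_{i+1},1}(q)\in\mathbb{C}(q_1,\ldots,q_r)$ given by $$A_{-\omega_i+\omega_{i+1},1}(q)=q_{i+1}^r\prod_{\substack{j=0\\ j\neq i}}^r\frac{q_j}{q_jq_{i+1}-q_{j+1}q_i}.$$
   Context: $\mathbb{N}=\{0,1,2,\ldots\}$. $\omega_1,\ldots,\omega_r$ are the fundamental weights of $\mathfrak{sl}(r+1,\mathbb{C})$ in the standard numbering, $\alpha_1^\vee,\ldots,\alpha_r^\vee$ the simple coroots, $X=\bigoplus_{i=1}^r\mathbb{Z}\omega_i$ the weight lattice, and $V(\omega_1)$ the irreducible representation of highest weight $\omega_1$; $S^NV(\omega_1)$ is its $N$-th symmetric power. For $x=\sum_j x_j\alpha_j^\vee$ with $x_j\in\mathbb{R}$, write $q_j=e^{ix_j}$, and for $\mu=c_1\omega_1+\cdots+c_r\omega_r$ write $q^\mu=q_1^{c_1}\cdots q_r^{c_r}=e^{i\langle\mu,x\rangle}$. For a representation $V$ with weight multiplicities $m_\mu$ (dimension of the $\mu$-weight space), the Fourier series of its character is $\operatorname{Char}V(ix)=\sum_{\mu\in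 X}m_\mu q^\mu$, regarded as a Laurent polynomial in $q_1,\ldots,q_r$ (in these exponentials and in $\operatorname{Char}(\cdot)(ix)$, $i$ is the imaginary unit; elsewhere it is an index). The formula is an identity in $\mathbb{C}(q_1,\ldots,q_r)$. *)

theory Defs
  imports
    "Jordan_Normal_Form.VS_Connect"
    "HOL-Algebra.AbelCoset"
    "HOL-Library.Poly_Mapping"
    "HOL-Computational_Algebra.Fraction_Field"
begin

section \<open>Representations of \<open>sl(r+1, \<complex>)\<close>\<close>

definition sl :: "nat \<Rightarrow> complex mat set" where
  "sl n = {A \<in> carrier_mat n n. (\<Sum>i<n. A $$ (i, i)) = 0}"

definition cartan :: "nat \<Rightarrow> complex mat set" where
  "cartan r = {H \<in> sl (r + 1). diagonal_mat H}"

definition strictly_upper :: "nat \<Rightarrow> complex mat set" where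
  "strictly_upper r = {A \<in> carrier_mat (r + 1) (r + 1). \<forall>i\<le>r. \<forall>j\<le>i. A $$ (i, j) = 0}"

text \<open>The ambient scalar field is \<^term>\<open>class_ring :: complex ring\<close>; representations are
  finite-dimensional. Outside \<^term>\<open>sl (r + 1)\<close> the map \<open>\<rho>\<close> is unconstrained.\<close>

definition sl_rep :: "nat \<Rightarrow> (complex, 'v) module \<Rightarrow> (complex mat \<Rightarrow> 'v \<Rightarrow> 'v) \<Rightarrow> bool" where
  "sl_rep r V \<rho> \<longleftrightarrow>
     vectorspace class_ring V \<and> vectorspace.fin_dim class_ring V \<and>
     (\<forall>A\<in>sl (r + 1). linear_map class_ring V V (\<rho> A)) \<and>
     (\<forall>A\<in>sl (r + 1). \<forall>B\<in>sl (r + 1). \<forall>v\<in>carrier V.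
        \<rho> (A + B) v = \<rho> A v \<oplus>\<^bsub>V\<^esub> \<rho> B v \<and>
        \<rho> (A * B - B * A) v = \<rho> A (\<rho> B v) \<ominus>\<^bsub>V\<^esub> \<rho> B (\<rho> A v)) \<and>
     (\<forall>c. \<forall>A\<in>sl (r + 1). \<forall>v\<in>carrier V. \<rho> (c \<cdot>\<^sub>m A) v = c \<odot>\<^bsub>V\<^esub> \<rho> A v)"

definition irreducible_sl_rep ::
    "nat \<Rightarrow> (complex, 'v) module \<Rightarrow> (complex mat \<Rightarrow> 'v \<Rightarrow> 'v) \<Rightarrow> bool" where
  "irreducible_sl_rep r V \<rho> \<longleftrightarrow>
     sl_rep r V \<rho> \<and> carrier V \<noteq> {\<zero>\<^bsub>V\<^esub>} \<and>
     (\<forall>W. VectorSpace.subspace class_ring W V \<and> (\<forall>A\<in>sl (r + 1). \<rho> A ` W \<subseteq> W) \<longrightarrow>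
        W = {\<zero>\<^bsub>V\<^esub>} \<or> W = carrier V)"

text \<open>Weights are linear functionals on the Cartan subalgebra of diagonal matrices.\<close>

definition weight_space ::
    "nat \<Rightarrow> (complex, 'v) module \<Rightarrow> (complex mat \<Rightarrow> 'v \<Rightarrow> 'v) \<Rightarrow> (complex mat \<Rightarrow> complex) \<Rightarrow> 'v set"
where
  "weight_space r V \<rho> \<mu> = {v \<in> carrier V. \<forall>H\<in>cartan r. \<rho> H v = \<mu> H \<odot>\<^bsub>V\<^esub> v}"

definition weight_mult ::
    "nat \<Rightarrow> (complex, 'v) module \<Rightarrow> (complex mat \<Rightarrow> 'v \<Rightarrow> 'v) \<Rightarrow> (complex mat \<Rightarrow> complex) \<Rightarrow> nat"
where
  "weight_mult r V \<rho> \<mu> = vectorspace.dim class_ring (V\<lparr>carrier := weight_space r V \<rho> \<mu>\<rparr>)"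

text \<open>Matrix indices start at \<open>0\<close>, so the coroot \<open>\<alpha>\<^sub>j\<^sup>\<or>\<close> is \<open>E\<^bsub>j-1,j-1\<^esub> - E\<^bsub>j,j\<^esub>\<close> for
  \<open>1 \<le> j \<le> r\<close>. The coroots form a basis of the Cartan subalgebra, and the fundamental weights
  are the dual basis.\<close>

definition coroot :: "nat \<Rightarrow> nat \<Rightarrow> complex mat" where
  "coroot r j = mat (r + 1) (r + 1)
     (\<lambda>(a, b). if a \<noteq> b then 0 else if a + 1 = j then 1 else if a = j then -1 else 0)"

definition fund_weight :: "nat \<Rightarrow> complex mat \<Rightarrow> complex" where
  "fund_weight i H = (\<Sum>k<i. H $$ (k, k))"

lemma coroot_in_cartan:
  assumes "j \<in> {1..r}"
  shows "coroot r j \<in> cartan r"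
proof -
  obtain m where m: "j = Suc m" "m < r" using assms by (cases j) auto
  have "(\<Sum>k<r + 1. coroot r j $$ (k, k)) =
      (\<Sum>k<r + 1. (if k = m then 1 else 0) - (if k = Suc m then 1 else 0 :: complex))"
    by (rule sum.cong) (auto simp: coroot_def m(1))
  also have "\<dots> = 0" using m(2)
    by (simp only: sum_subtractf sum.delta finite_lessThan) auto
  finally show ?thesis by (auto simp: cartan_def sl_def coroot_def diagonal_mat_def)
qed

lemma fund_weight_coroot:
  assumes "i \<in> {1..r}" "j \<in> {1..r}"
  shows "fund_weight i (coroot r j) = (if i = j then 1 else 0)"
proof -
  obtain m where m: "j = Suc m" "m < r" using assms by (cases j) auto
  have "fund_weight i (coroot r j) =
      (\<Sum>k<i. (if k = m then 1 else 0) - (if k = Suc m then 1 else 0 :: complex))"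
    unfolding fund_weight_def using assms
    by (intro sum.cong) (auto simp: coroot_def m(1))
  also have "\<dots> = (if i = j then 1 else 0)" using assms m by (auto simp: sum_subtractf)
  finally show ?thesis .
qed

text \<open>The weight \<open>c\<^sub>1\<omega>\<^sub>1 + \<dots> + c\<^sub>r\<omega>\<^sub>r\<close>. The weight lattice \<open>X\<close> is identified with the set
  \<^term>\<open>{1..r} \<rightarrow>\<^sub>E (UNIV :: int set)\<close> of coefficient families \<open>c\<close>.\<close>

definition weight_of :: "nat \<Rightarrow> (nat \<Rightarrow> int) \<Rightarrow> complex mat \<Rightarrow> complex" where
  "weight_of r c H = (\<Sum>i=1..r. of_int (c i) * fund_weight i H)"

text \<open>\<open>(V, \<rho>)\<close> is a model of the irreducible representation \<open>V(\<mu>)\<close> of highest weight \<open>\<mu>\<close>.\<close>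

definition irreducible_highest_weight_rep ::
    "nat \<Rightarrow> (complex mat \<Rightarrow> complex) \<Rightarrow> (complex, 'v) module \<Rightarrow> (complex mat \<Rightarrow> 'v \<Rightarrow> 'v) \<Rightarrow> bool"
where
  "irreducible_highest_weight_rep r \<mu> V \<rho> \<longleftrightarrow>
     irreducible_sl_rep r V \<rho> \<and>
     (\<exists>v \<in> weight_space r V \<rho> \<mu>. v \<noteq> \<zero>\<^bsub>V\<^esub> \<and> (\<forall>A\<in>strictly_upper r. \<rho> A v = \<zero>\<^bsub>V\<^esub>))"


section \<open>Symmetric powers\<close>

definition quotient_space :: "(complex, 'v) module \<Rightarrow> 'v set \<Rightarrow> (complex, 'v set) module" where
  "quotient_space M K =
     \<lparr>carrier = a_rcosets\<^bsub>M\<^esub> K, mult = (\<lambda>_ _. K), one = K, zero = K,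
      add = (\<lambda>X Y. X <+>\<^bsub>M\<^esub> Y),
      smult = (\<lambda>c X. K <+>\<^bsub>M\<^esub> ((\<lambda>x. c \<odot>\<^bsub>M\<^esub> x) ` X))\<rparr>"

text \<open>\<open>S\<^sup>NV\<close> is presented by generators \<open>v\<^sub>1\<cdots>v\<^sub>N\<close>, one for each list of \<open>N\<close> vectors, subject to the
  relations making the product multilinear and symmetric.\<close>

definition vec_lists :: "nat \<Rightarrow> (complex, 'v) module \<Rightarrow> 'v list set" where
  "vec_lists N V = {vs. length vs = N \<and> set vs \<subseteq> carrier V}"

definition free_space :: "'b set \<Rightarrow> (complex, 'b \<Rightarrow>\<^sub>0 complex) module" where
  "free_space B =
     \<lparr>carrier = {f. Poly_Mapping.keys f \<subseteq> B}, mult = (\<lambda>_ _. 0), one = 0, zero = 0,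
      add = (+), smult = (\<lambda>c. Poly_Mapping.map ((*) c))\<rparr>"

abbreviation gen :: "'b \<Rightarrow> 'b \<Rightarrow>\<^sub>0 complex" where
  "gen b \<equiv> Poly_Mapping.single b 1"

definition sym_relators :: "nat \<Rightarrow> (complex, 'v) module \<Rightarrow> ('v list \<Rightarrow>\<^sub>0 complex) set" where
  "sym_relators N V =
     {gen (vs[i := x \<oplus>\<^bsub>V\<^esub> y]) - gen (vs[i := x]) - gen (vs[i := y]) | vs i x y.
        vs \<in> vec_lists N V \<and> i < N \<and> x \<in> carrier V \<and> y \<in> carrier V}
   \<union> {gen (vs[i := c \<odot>\<^bsub>V\<^esub> x]) - Poly_Mapping.single (vs[i := x]) c | vs i c x.
        vs \<in> vec_lists N V \<and> i < N \<and> x \<in> carrier V}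
   \<union> {gen vs - gen ws | vs ws. vs \<in> vec_lists N V \<and> ws \<in> vec_lists N V \<and> mset vs = mset ws}"

definition sym_kernel :: "nat \<Rightarrow> (complex, 'v) module \<Rightarrow> ('v list \<Rightarrow>\<^sub>0 complex) set" where
  "sym_kernel N V =
     LinearCombinations.module.span class_ring (free_space (vec_lists N V)) (sym_relators N V)"

definition sym_power ::
    "nat \<Rightarrow> (complex, 'v) module \<Rightarrow> (complex, ('v list \<Rightarrow>\<^sub>0 complex) set) module" where
  "sym_power N V = quotient_space (free_space (vec_lists N V)) (sym_kernel N V)"

text \<open>The induced action \<open>A \<cdot> (v\<^sub>1\<cdots>v\<^sub>N) = \<Sum>\<^sub>i v\<^sub>1\<cdots>(A v\<^sub>i)\<cdots>v\<^sub>N\<close>, extended linearly to the free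
  space and then passed to cosets.\<close>

definition free_action ::
    "(complex mat \<Rightarrow> 'v \<Rightarrow> 'v) \<Rightarrow> complex mat \<Rightarrow> ('v list \<Rightarrow>\<^sub>0 complex) \<Rightarrow> ('v list \<Rightarrow>\<^sub>0 complex)"
where
  "free_action \<rho> A f =
     (\<Sum>vs\<in>Poly_Mapping.keys f. \<Sum>i<length vs.
        Poly_Mapping.single (vs[i := \<rho> A (vs ! i)]) (Poly_Mapping.lookup f vs))"

definition sym_action ::
    "nat \<Rightarrow> (complex, 'v) module \<Rightarrow> (complex mat \<Rightarrow> 'v \<Rightarrow> 'v) \<Rightarrow>
     complex mat \<Rightarrow> ('v list \<Rightarrow>\<^sub>0 complex) set \<Rightarrow> ('v list \<Rightarrow>\<^sub>0 complex) set"
where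
  "sym_action N V \<rho> A X =
     sym_kernel N V <+>\<^bsub>free_space (vec_lists N V)\<^esub> (free_action \<rho> A ` X)"


section \<open>Characters as rational functions\<close>

text \<open>Polynomials in variables indexed by \<^typ>\<open>nat\<close> are finitely supported maps from monomials
  \<^typ>\<open>nat \<Rightarrow>\<^sub>0 nat\<close> to coefficients. The field \<open>\<complex>(q\<^sub>1, \<dots>, q\<^sub>r)\<close> is the subset
  \<^term>\<open>rat_funs r\<close> of fractions involving the variables with indices \<open>1, \<dots>, r\<close> only.\<close>

type_synonym mpoly = "(nat \<Rightarrow>\<^sub>0 nat) \<Rightarrow>\<^sub>0 complex"
type_synonym rat_fun = "mpoly fract"

definition polys_in :: "nat set \<Rightarrow> mpoly set" where
  "polys_in I = {p. \<forall>m\<in>Poly_Mapping.keys p. Poly_Mapping.keys m \<subseteq> I}"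

definition rat_funs :: "nat \<Rightarrow> rat_fun set" where
  "rat_funs r = {Fract f g | f g. f \<in> polys_in {1..r} \<and> g \<in> polys_in {1..r} \<and> g \<noteq> 0}"

definition poly_var :: "nat \<Rightarrow> mpoly" where
  "poly_var i = Poly_Mapping.single (Poly_Mapping.single i 1) 1"

definition qvar :: "nat \<Rightarrow> nat \<Rightarrow> rat_fun" where
  "qvar r i = (if i \<in> {1..r} then Fract (poly_var i) 1 else 1)"

definition q_monomial :: "nat \<Rightarrow> (nat \<Rightarrow> int) \<Rightarrow> rat_fun" where
  "q_monomial r c = (\<Prod>i=1..r. qvar r i powi c i)"

text \<open>The summation is over the support of the multiplicity function, which is finite because the
  representations considered are finite-dimensional.\<close>

definition character ::
    "nat \<Rightarrow> (complex, 'v) module \<Rightarrow> (complex mat \<Rightarrow> 'v \<Rightarrow> 'v) \<Rightarrow> rat_fun" where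
  "character r V \<rho> =
     (\<Sum>c | c \<in> {1..r} \<rightarrow>\<^sub>E UNIV \<and> weight_mult r V \<rho> (weight_of r c) \<noteq> 0.
        of_nat (weight_mult r V \<rho> (weight_of r c)) * q_monomial r c)"

text \<open>The coefficient \<open>A\<^bsub>-\<omega>\<^sub>i+\<omega>\<^sub>i\<^sub>+\<^sub>1,1\<^esub>(q)\<close>, for \<open>0 \<le> i \<le> r\<close>; note that
  \<open>qvar r 0 = qvar r (r + 1) = 1\<close>.\<close>

definition A_coeff :: "nat \<Rightarrow> nat \<Rightarrow> rat_fun" where
  "A_coeff r i = qvar r (i + 1) ^ r *
     (\<Prod>j\<in>{0..r} - {i}. qvar r j / (qvar r j * qvar r (i + 1) - qvar r (j + 1) * qvar r i))"

end

theory Submission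
  imports Defs
begin

text \<open>
  The weights of \<open>V(\<omega>\<^sub>1)\<close> are the functionals \<open>\<epsilon>\<^sub>k = \<omega>\<^sub>k\<^sub>+\<^sub>1 - \<omega>\<^sub>k\<close> for \<open>0 \<le> k \<le> r\<close>, which send a diagonal
  matrix to its \<open>k\<close>-th entry, and each has multiplicity one. If \<open>e\<^sub>0, \<dots>, e\<^sub>r\<close> is a basis of weight
  vectors, the monomials of degree \<open>N\<close> in the \<open>e\<^sub>k\<close> form a basis of \<open>S\<^sup>NV(\<omega>\<^sub>1)\<close> of weight vectors. Hence,
  with \<open>x\<^sub>k = q\<^sub>k\<^sub>+\<^sub>1 / q\<^sub>k\<close> the exponential of \<open>\<epsilon>\<^sub>k\<close>, the character of \<open>S\<^sup>NV(\<omega>\<^sub>1)\<close> is the complete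
  homogeneous symmetric polynomial \<open>h\<^sub>N(x\<^sub>0, \<dots>, x\<^sub>r)\<close>. The formula is then the identity
  \<open>h\<^sub>N = \<Sum>\<^sub>k x\<^sub>k\<^sup>N\<^sup>+\<^sup>r / \<Prod>\<^sub>j\<^sub>\<noteq>\<^sub>k (x\<^sub>k - x\<^sub>j)\<close>, valid for pairwise distinct elements of any field
  (\<open>complete_homogeneous_eq_node_sum\<close>); clearing the denominators \<open>q\<^sub>k\<close> in \<open>x\<^sub>k\<close> produces the
  coefficients \<open>A\<close> (\<open>A_coeff_eq\<close>).

  Two facts about representations carry the argument. First, an irreducible representation with a
  highest weight vector \<open>v\<^sub>0\<close> of weight \<open>\<omega>\<^sub>1\<close> is the standard one: finite dimension forces powers of
  lowering operators to vanish on \<open>v\<^sub>0\<close> (\<open>sl2_lowering_power_vanishes\<close>), the commutation relations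
  then give \<open>E\<^sub>i\<^sub>j e\<^sub>k = \<delta>\<^sub>j\<^sub>k e\<^sub>i\<close> for \<open>e\<^sub>0 = v\<^sub>0\<close> and \<open>e\<^sub>k = E\<^sub>k\<^sub>0 v\<^sub>0\<close> (\<open>E_e\<close>), so these vectors span an invariant
  subspace, which irreducibility makes the whole space (\<open>span_e\<close>).

  Second, the abstract symmetric power is a space of polynomials. Sending a word of vectors to the
  product of their coordinate forms is a linear map \<open>evaluate\<close> from the free space to a polynomial
  ring. Its kernel is exactly the span of the defining relations (\<open>sym_kernel_iff\<close>), and it turns the
  action of a diagonal matrix into a derivation that multiplies every monomial by its weight
  (\<open>evaluate_free_action\<close>). A weight space of \<open>S\<^sup>NV\<close> is therefore isomorphic to the free space on the
  monomials of that weight (\<open>weight_mult_sym_power\<close>). Distinct monomials of the same degree have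
  distinct weights (\<open>weight_coeff_inject\<close>), so all multiplicities are \<open>0\<close> or \<open>1\<close>.
\<close>

section \<open>Complete homogeneous symmetric polynomials\<close>

definition complete_homogeneous :: "('i \<Rightarrow> 'a::comm_ring_1) \<Rightarrow> nat \<Rightarrow> 'i set \<Rightarrow> 'a" where
  "complete_homogeneous x n I = (\<Sum>M | set_mset M \<subseteq> I \<and> size M = n. \<Prod>k\<in>#M. x k)"

lemma finite_multisets_of_size:
  "finite I \<Longrightarrow> finite {M. set_mset M \<subseteq> I \<and> size M = n}"
proof (induction n)
  case 0
  have "{M. set_mset M \<subseteq> I \<and> size M = 0} \<subseteq> {{#}}" by auto
  then show ?case using finite_subset by blast
next
  case (Suc n)
  have "{M. set_mset M \<subseteq> I \<and> size M = Suc n} \<subseteq>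
      (\<lambda>(k, M). add_mset k M) ` (I \<times> {M. set_mset M \<subseteq> I \<and> size M = n})"
  proof
    fix M assume M: "M \<in> {M. set_mset M \<subseteq> I \<and> size M = Suc n}"
    then obtain k M' where "M = add_mset k M'" 
      by (auto dest: size_eq_Suc_imp_eq_union)
    with M show "M \<in> (\<lambda>(k, M). add_mset k M) ` (I \<times> {M. set_mset M \<subseteq> I \<and> size M = n})"
      by (intro image_eqI[of _ _ "(k, M')"]) auto
  qed
  with Suc show ?case by (auto intro: finite_subset)
qed

lemma complete_homogeneous_0 [simp]: "complete_homogeneous x 0 I = 1"
proof -
  have "{M. set_mset M \<subseteq> I \<and> size M = 0} = {{#}}" by auto
  then show ?thesis by (simp add: complete_homogeneous_def)
qed

lemma complete_homogeneous_empty [simp]: "complete_homogeneous x (Suc n) {} = 0"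
proof -
  have "{M. set_mset M \<subseteq> {} \<and> size M = Suc n} = {}" by auto
  then show ?thesis unfolding complete_homogeneous_def by (metis sum.empty)
qed

text \<open>The monomials that contain \<open>y\<close> are \<open>y\<close> times an arbitrary monomial of one
  degree less; the others do not involve \<open>y\<close>.\<close>

lemma complete_homogeneous_insert:
  assumes "finite I" "y \<notin> I"
  shows "complete_homogeneous x (Suc n) (insert y I) =
    x y * complete_homogeneous x n (insert y I) + complete_homogeneous x (Suc n) I"
proof -
  let ?A = "\<lambda>n I. {M. set_mset M \<subseteq> I \<and> size M = n}"
  have split: "?A (Suc n) (insert y I) = add_mset y ` ?A n (insert y I) \<union> ?A (Suc n) I"
  proof (intro equalityI subsetI)
    fix M assume M: "M \<in> ?A (Suc n) (insert y I)"
    show "M \<in> add_mset y ` ?A n (insert y I) \<union> ?A (Suc n) I"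
    proof (cases "y \<in># M")
      case True
      then obtain M' where "M = add_mset y M'" by (meson mset_add)
      with M show ?thesis by auto
    next
      case False
      with M show ?thesis by auto
    qed
  qed auto
  have "complete_homogeneous x (Suc n) (insert y I) =
      (\<Sum>M\<in>add_mset y ` ?A n (insert y I). \<Prod>k\<in>#M. x k) + (\<Sum>M\<in>?A (Suc n) I. \<Prod>k\<in>#M. x k)"
    unfolding complete_homogeneous_def split
    using assms by (intro sum.union_disjoint) (auto simp: finite_multisets_of_size)
  also have "(\<Sum>M\<in>add_mset y ` ?A n (insert y I). \<Prod>k\<in>#M. x k) =
      x y * complete_homogeneous x n (insert y I)"
    by (simp add: sum.reindex inj_on_def complete_homogeneous_def sum_distrib_left)
  finally show ?thesis by (simp add: complete_homogeneous_def)
qed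

text \<open>The coefficient of the value at the node \<open>x\<^sub>k\<close> in the divided difference over
  all nodes.\<close>

definition node_weight :: "('i \<Rightarrow> 'a::field) \<Rightarrow> 'i set \<Rightarrow> 'i \<Rightarrow> 'a" where
  "node_weight x I k = (\<Prod>j\<in>I - {k}. 1 / (x k - x j))"

text \<open>Multiplication by \<open>x\<^sub>k - x\<^sub>y\<close> cancels the factor contributed by the node \<open>y\<close>
  to the weight of \<open>k\<close>, and kills the summand of \<open>y\<close> itself. This is the recurrence
  that \<open>complete_homogeneous_insert\<close> gives on the other side.\<close>

lemma node_power_sum_insert:
  assumes "finite I" "y \<notin> I" "inj_on x (insert y I)"
  shows "(\<Sum>k\<in>insert y I. x k ^ Suc m * node_weight x (insert y I) k) =
    x y * (\<Sum>k\<in>insert y I. x k ^ m * node_weight x (insert y I) k) +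
    (\<Sum>k\<in>I. x k ^ m * node_weight x I k)"
proof -
  have w: "(x k - x y) * node_weight x (insert y I) k = node_weight x I k" if "k \<in> I" for k
  proof -
    have "insert y I - {k} = insert y (I - {k})" using assms that by auto
    moreover have "x k \<noteq> x y" using assms that by (metis inj_onD insertCI)
    ultimately show ?thesis using assms by (simp add: node_weight_def)
  qed
  have "(\<Sum>k\<in>insert y I. x k ^ Suc m * node_weight x (insert y I) k) -
      x y * (\<Sum>k\<in>insert y I. x k ^ m * node_weight x (insert y I) k) =
      (\<Sum>k\<in>insert y I. x k ^ m * ((x k - x y) * node_weight x (insert y I) k))"
    by (simp add: sum_distrib_left sum_subtractf algebra_simps)
  also have "\<dots> = (\<Sum>k\<in>I. x k ^ m * node_weight x I k)"
    using assms(1,2) by (simp add: w)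
  finally show ?thesis by (simp add: algebra_simps)
qed

text \<open>Divided differences annihilate constants. Removing either of two nodes \<open>y\<close> and
  \<open>z\<close> in the recurrence gives \<open>(x\<^sub>y - x\<^sub>z) S\<close> as a difference of two smaller sums,
  which agree: both are \<open>0\<close> by induction, or both are \<open>1\<close> when one node remains.\<close>

lemma sum_node_weight:
  assumes "finite I" "inj_on x I" "card I \<ge> 2"
  shows "(\<Sum>k\<in>I. node_weight x I k) = 0"
  using assms
proof (induction "card I" arbitrary: I rule: less_induct)
  case less
  let ?S = "\<lambda>m I. \<Sum>k\<in>I. x k ^ m * node_weight x I k"
  obtain y where y: "y \<in> I" using less.prems by fastforce
  have "card (I - {y}) \<ge> 1" using less.prems y by simp
  then obtain z where z: "z \<in> I - {y}" by (metis card.empty ex_in_conv not_one_le_zero)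
  have rec: "?S 1 I = x k * ?S 0 I + ?S 0 (I - {k})" if "k \<in> I" for k
    using node_power_sum_insert[of "I - {k}" k x 0] that less.prems by (simp add: insert_absorb)
  have eq: "?S 0 (I - {y}) = ?S 0 (I - {z})"
  proof (cases "card I = 2")
    case True
    have singleton: "?S 0 J = 1" if "card J = 1" for J
      using that by (auto simp: card_1_singleton_iff node_weight_def)
    show ?thesis using True y z less.prems by (subst (1 2) singleton) simp_all
  next
    case False
    have "?S 0 (I - {k}) = 0" if "k \<in> I" for k
      using less.hyps[of "I - {k}"] less.prems that False card_Diff1_less[of I k]
      by (auto simp: inj_on_diff)
    then show ?thesis using y z by simp
  qed
  have "(x y - x z) * ?S 0 I = 0"
    using rec[of y] rec[of z] y z eq by (simp add: algebra_simps)
  moreover have "x y \<noteq> x z" using less.prems y z by (auto dest: inj_onD)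
  ultimately show ?case by simp
qed

text \<open>Divided differences over \<open>card I\<close> nodes annihilate all powers below \<open>card I -
  1\<close>; the recurrence lowers the exponent and, in its second term, also the number of
  nodes.\<close>

lemma node_power_sum_low:
  assumes "finite I" "inj_on x I" "m + 1 < card I"
  shows "(\<Sum>k\<in>I. x k ^ m * node_weight x I k) = 0"
  using assms
proof (induction m arbitrary: I)
  case 0
  then show ?case using sum_node_weight[of I x] by simp
next
  case (Suc m)
  then obtain y where y: "y \<in> I" by fastforce
  have "(\<Sum>k\<in>I - {y}. x k ^ m * node_weight x (I - {y}) k) = 0"
    "(\<Sum>k\<in>I. x k ^ m * node_weight x I k) = 0"
    using Suc.prems y by (auto intro!: Suc.IH simp: inj_on_diff)
  then show ?case
    using node_power_sum_insert[of "I - {y}" y x m] y Suc.prems by (simp add: insert_absorb)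
qed

text \<open>Both sides obey the same recurrence in the degree and in the set of nodes. The
  initial value in degree \<open>0\<close> is the divided difference of the \<open>d\<close>-th power over \<open>d
  + 1\<close> nodes, which equals \<open>1\<close>.\<close>

theorem complete_homogeneous_eq_node_sum:
  assumes "finite I" "inj_on x I" "card I = Suc d"
  shows "complete_homogeneous x n I = (\<Sum>k\<in>I. x k ^ (n + d) * node_weight x I k)"
  using assms
proof (induction n arbitrary: I d)
  case 0
  then show ?case
  proof (induction d arbitrary: I)
    case 0
    then show ?case by (auto simp: card_1_singleton_iff node_weight_def)
  next
    case (Suc d)
    then obtain y where y: "y \<in> I" by fastforce
    have "(\<Sum>k\<in>I. x k ^ d * node_weight x I k) = 0"
      using Suc.prems by (intro node_power_sum_low) auto
    moreover have "(\<Sum>k\<in>I - {y}. x k ^ d * node_weight x (I - {y}) k) = 1"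
      using Suc.IH[of "I - {y}"] Suc.prems y by (simp add: inj_on_diff)
    ultimately show ?case
      using node_power_sum_insert[of "I - {y}" y x d] y Suc.prems by (simp add: insert_absorb)
  qed
next
  case (Suc n)
  note IH = Suc.IH
  show ?case using Suc.prems
  proof (induction d arbitrary: I)
    case 0
    then obtain y where [simp]: "I = {y}" by (auto simp: card_1_singleton_iff)
    have "complete_homogeneous x (Suc n) {y} = x y * complete_homogeneous x n {y}"
      by (simp add: complete_homogeneous_insert)
    then show ?case using IH[of "{y}" 0] by (simp add: algebra_simps)
  next
    case (Suc d)
    then obtain y where y: "y \<in> I" by fastforce
    have "complete_homogeneous x (Suc n) I =
        x y * complete_homogeneous x n I + complete_homogeneous x (Suc n) (I - {y})"
      using complete_homogeneous_insert[of "I - {y}" y x n] y Suc.prems by (simp add: insert_absorb)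
    also have "complete_homogeneous x n I = (\<Sum>k\<in>I. x k ^ (n + Suc d) * node_weight x I k)"
      using IH[of I "Suc d"] Suc.prems by simp
    also have "complete_homogeneous x (Suc n) (I - {y}) =
        (\<Sum>k\<in>I - {y}. x k ^ (Suc n + d) * node_weight x (I - {y}) k)"
      using Suc.IH[of "I - {y}"] Suc.prems y by (simp add: inj_on_diff)
    finally show ?case
      using node_power_sum_insert[of "I - {y}" y x "n + Suc d"] y Suc.prems
      by (simp add: insert_absorb)
  qed
qed

section \<open>Rational functions in the fundamental exponentials\<close>

lemma polys_in_mult: "p \<in> polys_in I \<Longrightarrow> q \<in> polys_in I \<Longrightarrow> p * q \<in> polys_in I"
proof -
  assume p: "p \<in> polys_in I" and q: "q \<in> polys_in I"
  have "Poly_Mapping.keys m \<subseteq> I" if m: "m \<in> Poly_Mapping.keys (p * q)" for m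
  proof -
    obtain a b where "m = a + b" "a \<in> Poly_Mapping.keys p" "b \<in> Poly_Mapping.keys q"
      using m keys_mult[of p q] by blast
    then show ?thesis using p q keys_add[of a b] unfolding polys_in_def by blast
  qed
  then show ?thesis by (simp add: polys_in_def)
qed

lemma polys_in_diff: "p \<in> polys_in I \<Longrightarrow> q \<in> polys_in I \<Longrightarrow> p - q \<in> polys_in I"
proof -
  assume p: "p \<in> polys_in I" and q: "q \<in> polys_in I"
  have "Poly_Mapping.keys (p - q) \<subseteq> Poly_Mapping.keys p \<union> Poly_Mapping.keys q"
    by (auto simp: in_keys_iff lookup_minus)
  then show ?thesis using p q unfolding polys_in_def by blast
qed

lemma polys_in_0 [simp]: "0 \<in> polys_in I" and polys_in_1 [simp]: "1 \<in> polys_in I"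
  by (auto simp: polys_in_def)

lemma rat_funsI:
  "f \<in> polys_in {1..r} \<Longrightarrow> g \<in> polys_in {1..r} \<Longrightarrow> g \<noteq> 0 \<Longrightarrow> Fract f g \<in> rat_funs r"
  unfolding rat_funs_def by blast

lemma rat_funsE:
  assumes "h \<in> rat_funs r"
  obtains f g where "h = Fract f g" "f \<in> polys_in {1..r}" "g \<in> polys_in {1..r}" "g \<noteq> 0"
  using assms unfolding rat_funs_def by blast

lemma rat_fun_mult: "f \<in> rat_funs r \<Longrightarrow> g \<in> rat_funs r \<Longrightarrow> f * g \<in> rat_funs r"
  by (elim rat_funsE) (simp add: rat_funsI polys_in_mult)

lemma rat_fun_diff: "f \<in> rat_funs r \<Longrightarrow> g \<in> rat_funs r \<Longrightarrow> f - g \<in> rat_funs r"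
  by (elim rat_funsE) (simp add: rat_funsI polys_in_mult polys_in_diff)

lemma rat_fun_const: "0 \<in> rat_funs r" "1 \<in> rat_funs r"
  unfolding Zero_fract_def One_fract_def by (auto intro!: rat_funsI)

lemma rat_fun_inverse:
  assumes "f \<in> rat_funs r" shows "inverse f \<in> rat_funs r"
proof -
  obtain p q where pq: "f = Fract p q" "p \<in> polys_in {1..r}" "q \<in> polys_in {1..r}" "q \<noteq> 0"
    using assms by (auto simp: rat_funs_def)
  show ?thesis
  proof (cases "p = 0")
    case True
    then show ?thesis using pq rat_fun_const by (simp add: fract_collapse)
  next
    case False
    then show ?thesis using pq by (auto simp: rat_funs_def)
  qed
qed

lemma rat_fun_divide: "f \<in> rat_funs r \<Longrightarrow> g \<in> rat_funs r \<Longrightarrow> f / g \<in> rat_funs r"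
  by (simp add: divide_inverse rat_fun_mult rat_fun_inverse)

lemma rat_fun_prod: "(\<And>k. k \<in> I \<Longrightarrow> f k \<in> rat_funs r) \<Longrightarrow> prod f I \<in> rat_funs r"
  by (induction I rule: infinite_finite_induct) (auto simp: rat_fun_const rat_fun_mult)

lemma rat_fun_power: "f \<in> rat_funs r \<Longrightarrow> f ^ n \<in> rat_funs r"
  by (induction n) (auto simp: rat_fun_const rat_fun_mult)

lemma qvar_in_rat_funs: "qvar r i \<in> rat_funs r"
proof (cases "i \<in> {1..r}")
  case True
  then have "poly_var i \<in> polys_in {1..r}" by (auto simp: polys_in_def poly_var_def)
  then show ?thesis using True by (auto simp: qvar_def intro!: rat_funsI)
next
  case False
  then show ?thesis by (simp only: qvar_def if_False rat_fun_const)
qed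

lemma A_coeff_in_rat_funs: "A_coeff r i \<in> rat_funs r"
  unfolding A_coeff_def
  by (intro rat_fun_mult rat_fun_power rat_fun_prod rat_fun_divide rat_fun_diff qvar_in_rat_funs)

text \<open>The exponential of the weight \<open>\<omega>\<^sub>k\<^sub>+\<^sub>1 - \<omega>\<^sub>k\<close>; these are the nodes \<open>x\<^sub>k\<close> of
  the preceding section.\<close>

definition node :: "nat \<Rightarrow> nat \<Rightarrow> rat_fun" where
  "node r k = qvar r (k + 1) / qvar r k"

text \<open>The exponent vector of \<open>q\<^sub>i\<close>, zero at both ends because \<open>q\<^sub>0 = q\<^sub>r\<^sub>+\<^sub>1 = 1\<close>.
  Products of the \<open>q\<^sub>i\<close> can thus be compared through their exponents.\<close>

definition qexp :: "nat \<Rightarrow> nat \<Rightarrow> (nat \<Rightarrow>\<^sub>0 nat)" where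
  "qexp r i = (if i \<in> {1..r} then Poly_Mapping.single i 1 else 0)"

lemma qvar_mult: "qvar r i * qvar r j = Fract (Poly_Mapping.single (qexp r i + qexp r j) 1) 1"
  by (auto simp: qvar_def qexp_def poly_var_def mult_single One_fract_def[symmetric])

lemma qvar_nonzero [simp]: "qvar r i \<noteq> 0"
proof -
  have "Fract (Poly_Mapping.single (qexp r i + qexp r i) (1::complex)) 1 \<noteq> 0"
    by (simp add: Zero_fract_def eq_fract) (metis lookup_single_eq lookup_zero zero_neq_one)
  then show ?thesis using qvar_mult[of r i i] by auto
qed

text \<open>For \<open>j < k\<close>, equality of the nodes would mean \<open>q\<^sub>j\<^sub>+\<^sub>1 q\<^sub>k = q\<^sub>k\<^sub>+\<^sub>1 q\<^sub>j\<close>.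
  Here \<open>1 \<le> k \<le> r\<close>, so \<open>q\<^sub>k\<close> is a genuine variable, and it occurs only on the left.\<close>

lemma inj_on_node: "inj_on (node r) {0..r}"
proof (rule linorder_inj_onI')
  fix j k assume jk: "j \<in> {0..r}" "k \<in> {0..r}" "j < k"
  show "node r j \<noteq> node r k"
  proof
    assume "node r j = node r k"
    then have "qvar r (j + 1) * qvar r k = qvar r (k + 1) * qvar r j"
      by (simp add: node_def divide_simps) 
    then have "Poly_Mapping.single (qexp r (j + 1) + qexp r k) (1::complex) =
        Poly_Mapping.single (qexp r (k + 1) + qexp r j) 1"
      unfolding qvar_mult by (simp add: eq_fract)
    then have "qexp r (j + 1) + qexp r k = qexp r (k + 1) + qexp r j"
      by (metis keys_single singleton_inject zero_neq_one)
    then have "Poly_Mapping.lookup (qexp r (j + 1)) k + Poly_Mapping.lookup (qexp r k) k =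
        Poly_Mapping.lookup (qexp r (k + 1)) k + Poly_Mapping.lookup (qexp r j) k"
      by (metis lookup_add)
    moreover have "Poly_Mapping.lookup (qexp r (j + 1)) k + Poly_Mapping.lookup (qexp r k) k \<ge> 1"
      "Poly_Mapping.lookup (qexp r (k + 1)) k = 0" "Poly_Mapping.lookup (qexp r j) k = 0"
      using jk by (auto simp: qexp_def lookup_single)
    ultimately show False by linarith
  qed
qed

text \<open>Each of the \<open>r\<close> factors contributes one \<open>q\<^sub>i\<close> to the denominator, and together
  these turn \<open>q\<^sub>i\<^sub>+\<^sub>1\<^sup>r\<close> into the \<open>r\<close>-th power of the node.\<close>

lemma A_coeff_eq:
  assumes "i \<in> {0..r}"
  shows "A_coeff r i = node r i ^ r * node_weight (node r) {0..r} i"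
proof -
  have card: "card ({0..r} - {i}) = r" using assms by simp
  have factor: "qvar r j / (qvar r j * qvar r (i + 1) - qvar r (j + 1) * qvar r i) =
      1 / qvar r i * (1 / (node r i - node r j))" if "j \<in> {0..r} - {i}" for j
  proof -
    have "node r i - node r j \<noteq> 0" using that assms inj_on_node[of r] by (auto dest: inj_onD)
    moreover have "qvar r j * qvar r (i + 1) - qvar r (j + 1) * qvar r i =
        qvar r i * qvar r j * (node r i - node r j)"
      by (simp add: node_def field_simps)
    ultimately show ?thesis by simp
  qed
  have "A_coeff r i = qvar r (i + 1) ^ r * (\<Prod>j\<in>{0..r} - {i}. 1 / qvar r i * (1 / (node r i - node r j)))"
    unfolding A_coeff_def using factor by (intro arg_cong2[of _ _ _ _ "(*)"] prod.cong refl) 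
  also have "\<dots> = node r i ^ r * node_weight (node r) {0..r} i"
    unfolding prod.distrib node_weight_def by (simp add: card node_def power_divide power_one_over)
  finally show ?thesis .
qed

lemma complete_homogeneous_node:
  "complete_homogeneous (node r) N {0..r} =
     (\<Sum>i=0..r. qvar r i powi (- int N) * qvar r (i + 1) ^ N * A_coeff r i)"
proof -
  have "complete_homogeneous (node r) N {0..r} =
      (\<Sum>i=0..r. node r i ^ (N + r) * node_weight (node r) {0..r} i)"
    by (intro complete_homogeneous_eq_node_sum inj_on_node) auto
  also have "\<dots> = (\<Sum>i=0..r. qvar r i powi (- int N) * qvar r (i + 1) ^ N * A_coeff r i)"
  proof (intro sum.cong refl)
    fix i assume "i \<in> {0..r}"
    moreover have "node r i ^ N = qvar r i powi (- int N) * qvar r (i + 1) ^ N"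
      by (simp add: node_def power_int_minus power_divide field_simps)
    ultimately show "node r i ^ (N + r) * node_weight (node r) {0..r} i =
        qvar r i powi (- int N) * qvar r (i + 1) ^ N * A_coeff r i"
      by (simp only: A_coeff_eq power_add mult.assoc)
  qed
  finally show ?thesis .
qed

section \<open>Free spaces and linear extension\<close>

abbreviation scale :: "complex \<Rightarrow> ('b \<Rightarrow>\<^sub>0 complex) \<Rightarrow> ('b \<Rightarrow>\<^sub>0 complex)" where
  "scale c \<equiv> Poly_Mapping.map ((*) c)"

lemma lookup_scale [simp]: "Poly_Mapping.lookup (scale c f) b = c * Poly_Mapping.lookup f b"
  by (simp add: Poly_Mapping.map.rep_eq when_def)

interpretation scale: vector_space scale
  by unfold_locales (auto intro!: poly_mapping_eqI simp: lookup_add algebra_simps)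

lemma keys_scale: "Poly_Mapping.keys (scale c f) \<subseteq> Poly_Mapping.keys f"
  by (auto simp: in_keys_iff)

lemma keys_diff_subset: "Poly_Mapping.keys (f - g) \<subseteq> Poly_Mapping.keys f \<union> Poly_Mapping.keys (g :: 'b \<Rightarrow>\<^sub>0 complex)"
  by (auto simp: in_keys_iff lookup_minus)

lemma free_space_simps [simp]:
  "carrier (free_space B) = {f. Poly_Mapping.keys f \<subseteq> B}"
  "zero (free_space B) = 0" "add (free_space B) = (+)" "module.smult (free_space B) = scale"
  by (simp_all add: free_space_def)

lemma free_space_induct [consumes 1, case_names zero single add]:
  fixes f :: "'b \<Rightarrow>\<^sub>0 complex"
  assumes "Poly_Mapping.keys f \<subseteq> B" "P 0"
    and "\<And>b c. b \<in> B \<Longrightarrow> P (Poly_Mapping.single b c)"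
    and "\<And>f g. P f \<Longrightarrow> P g \<Longrightarrow> P (f + g)"
  shows "P f"
proof -
  have "P (\<Sum>b\<in>S. Poly_Mapping.single b (Poly_Mapping.lookup f b))" if "finite S" "S \<subseteq> B" for S
    using that by (induction S rule: finite_induct) (auto intro: assms)
  moreover have "f = (\<Sum>b\<in>Poly_Mapping.keys f. Poly_Mapping.single b (Poly_Mapping.lookup f b))"
    by (rule poly_mapping_eqI) (simp add: lookup_sum lookup_single when_def in_keys_iff)
  ultimately show ?thesis using assms(1) by (metis finite_keys)
qed

definition lin_ext :: "('b \<Rightarrow> ('c \<Rightarrow>\<^sub>0 complex)) \<Rightarrow> ('b \<Rightarrow>\<^sub>0 complex) \<Rightarrow> ('c \<Rightarrow>\<^sub>0 complex)" where
  "lin_ext g f = (\<Sum>b\<in>Poly_Mapping.keys f. scale (Poly_Mapping.lookup f b) (g b))"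

lemma lin_ext_superset:
  "finite S \<Longrightarrow> Poly_Mapping.keys f \<subseteq> S \<Longrightarrow>
     lin_ext g f = (\<Sum>b\<in>S. scale (Poly_Mapping.lookup f b) (g b))"
  unfolding lin_ext_def by (rule sum.mono_neutral_left) (auto simp: in_keys_iff)

lemma lin_ext_add: "lin_ext g (f + h) = lin_ext g f + lin_ext g h"
proof -
  let ?S = "Poly_Mapping.keys f \<union> Poly_Mapping.keys h"
  have "lin_ext g k = (\<Sum>b\<in>?S. scale (Poly_Mapping.lookup k b) (g b))" if "k \<in> {f, h, f + h}" for k
    using that keys_add[of f h] by (intro lin_ext_superset) auto
  then show ?thesis by (simp add: lookup_add scale.scale_left_distrib sum.distrib)
qed

lemma lin_ext_scale: "lin_ext g (scale c f) = scale c (lin_ext g f)"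
  unfolding lin_ext_superset[OF finite_keys keys_scale[of c f], of g]
  by (simp add: lin_ext_def scale.scale_sum_right)

lemma lin_ext_single [simp]: "lin_ext g (Poly_Mapping.single b c) = scale c (g b)"
  by (simp add: lin_ext_def)

lemma lin_ext_0 [simp]: "lin_ext g 0 = 0"
  by (simp add: lin_ext_def)

lemma lin_ext_diff: "lin_ext g (f - h) = lin_ext g f - lin_ext g h"
  by (metis lin_ext_add add_diff_cancel_right' diff_add_cancel)

lemma keys_lin_ext:
  assumes "Poly_Mapping.keys f \<subseteq> B" "\<And>b. b \<in> B \<Longrightarrow> Poly_Mapping.keys (g b) \<subseteq> C"
  shows "Poly_Mapping.keys (lin_ext g f) \<subseteq> C"
  using assms(1)
proof (induction f rule: free_space_induct)
  case (single b c)
  then show ?case using assms(2) keys_scale by (metis lin_ext_single subset_trans)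
next
  case (add f h)
  then show ?case using keys_add by (metis lin_ext_add Un_least subset_trans)
qed auto

lemma lin_ext_cong:
  assumes "Poly_Mapping.keys f \<subseteq> B" "\<And>b. b \<in> B \<Longrightarrow> g b = g' b"
  shows "lin_ext g f = lin_ext g' f"
  unfolding lin_ext_def using assms by (auto intro!: sum.cong)

lemma lin_ext_compose:
  "lin_ext g (lin_ext h f) = lin_ext (\<lambda>b. lin_ext g (h b)) f"
proof -
  have "Poly_Mapping.keys f \<subseteq> UNIV" by simp
  then show ?thesis
    by (induction f rule: free_space_induct) (simp_all add: lin_ext_add lin_ext_scale)
qed

lemma free_space_vectorspace: "vectorspace class_ring (free_space B)"
proof (rule vs_criteria)
  show "\<forall>v\<in>carrier (free_space B). \<exists>w\<in>carrier (free_space B). v \<oplus>\<^bsub>free_space B\<^esub> w = \<zero>\<^bsub>free_space B\<^esub>"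
  proof
    fix v assume "v \<in> carrier (free_space B)"
    then have "- v \<in> carrier (free_space B)" by (auto simp: in_keys_iff)
    then show "\<exists>w\<in>carrier (free_space B). v \<oplus>\<^bsub>free_space B\<^esub> w = \<zero>\<^bsub>free_space B\<^esub>"
      by (intro bexI[of _ "- v"]) simp_all
  qed
  show "\<forall>v w. v \<in> carrier (free_space B) \<and> w \<in> carrier (free_space B) \<longrightarrow>
      v \<oplus>\<^bsub>free_space B\<^esub> w \<in> carrier (free_space B)"
    using keys_add by fastforce
  show "\<forall>c v. c \<in> carrier class_ring \<and> v \<in> carrier (free_space B) \<longrightarrow>
      c \<odot>\<^bsub>free_space B\<^esub> v \<in> carrier (free_space B)"
    using keys_scale by fastforce
qed (simp_all add: class_field algebra_simps scale.scale_right_distrib scale.scale_left_distrib)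

lemma finsum_free_space:
  assumes "finite S" "\<And>b. b \<in> S \<Longrightarrow> Poly_Mapping.keys (f b) \<subseteq> B"
  shows "finsum (free_space B) f S = sum f S"
proof -
  interpret F: vectorspace class_ring "free_space B" by (rule free_space_vectorspace)
  show ?thesis using assms by (induction S rule: finite_induct) auto
qed

lemma free_space_basis:
  assumes "finite B"
  shows "vectorspace.fin_dim class_ring (free_space B)" "vectorspace.dim class_ring (free_space B) = card B"
proof -
  interpret F: vectorspace class_ring "free_space B" by (rule free_space_vectorspace)
  have inj: "inj_on (gen :: 'a \<Rightarrow> _) B"
    by (rule inj_onI) (metis keys_single singleton_inject zero_neq_one)
  have lincomb: "F.lincomb a (gen ` B) = (\<Sum>b\<in>B. Poly_Mapping.single b (a (gen b)))" for a
  proof -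
    have "F.lincomb a (gen ` B) = (\<Sum>g\<in>gen ` B. scale (a g) g)"
      unfolding F.lincomb_def free_space_simps using assms
      by (intro finsum_free_space) (auto simp: in_keys_iff lookup_single when_def split: if_splits)
    then show ?thesis by (simp add: sum.reindex[OF inj])
  qed
  have sub: "gen ` B \<subseteq> carrier (free_space B)" by auto
  have gen: "f \<in> F.span (gen ` B)" if "f \<in> carrier (free_space B)" for f
  proof -
    have "f = (\<Sum>b\<in>B. Poly_Mapping.single b (Poly_Mapping.lookup f b))"
      using that assms
      by (intro poly_mapping_eqI) (auto simp: lookup_sum lookup_single when_def in_keys_iff)
    also have "\<dots> = (\<Sum>b\<in>B. Poly_Mapping.single b (Poly_Mapping.lookup f (the_inv_into B gen (gen b))))"
      by (intro sum.cong refl) (simp add: the_inv_into_f_f[OF inj])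
    also have "\<dots> = F.lincomb (\<lambda>g. Poly_Mapping.lookup f (the_inv_into B gen g)) (gen ` B)"
      by (simp only: lincomb)
    finally have f: "f = F.lincomb (\<lambda>g. Poly_Mapping.lookup f (the_inv_into B gen g)) (gen ` B)" .
    show ?thesis
      unfolding F.span_def mem_Collect_eq
      by (intro exI conjI) (rule f, use assms in auto)
  qed
  have indep: "F.lin_indpt (gen ` B)"
  proof (rule F.finite_lin_indpt2)
    fix a assume "F.lincomb a (gen ` B) = \<zero>\<^bsub>free_space B\<^esub>"
    then have zero: "Poly_Mapping.lookup (\<Sum>b\<in>B. Poly_Mapping.single b (a (gen b))) b = 0" for b
      by (simp add: lincomb)
    have "a (gen b) = 0" if "b \<in> B" for b
      using assms that zero[of b] by (simp add: lookup_sum lookup_single when_def)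
    then show "\<forall>v\<in>gen ` B. a v = \<zero>\<^bsub>class_ring\<^esub>" by simp
  qed (use assms sub in auto)
  have "F.span (gen ` B) = carrier (free_space B)"
    using gen F.span_is_subset2[OF sub] by blast
  then have "F.basis (gen ` B)" using indep sub by (simp add: F.basis_def)
  then show "F.dim = card B"
    using assms F.dim_basis[of "gen ` B"] card_image[OF inj] by simp
  show "F.fin_dim" unfolding F.fin_dim_def using assms sub \<open>F.span (gen ` B) = _\<close> by blast
qed

text \<open>The vector space axioms are equations, so they pass along any surjection that
  respects the operations. This spares a verification of the axioms on cosets, where
  only the image of an explicit vector space is at hand.\<close>

lemma linear_map_onto:
  fixes W :: "(complex, 'w) module" and U :: "(complex, 'u) module"
  assumes U: "vectorspace class_ring U" and surj: "T ` carrier U = carrier W"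
    and add: "\<And>x y. x \<in> carrier U \<Longrightarrow> y \<in> carrier U \<Longrightarrow> T (x \<oplus>\<^bsub>U\<^esub> y) = T x \<oplus>\<^bsub>W\<^esub> T y"
    and smult: "\<And>c x. x \<in> carrier U \<Longrightarrow> T (c \<odot>\<^bsub>U\<^esub> x) = c \<odot>\<^bsub>W\<^esub> T x"
    and zero: "T \<zero>\<^bsub>U\<^esub> = \<zero>\<^bsub>W\<^esub>"
  shows "linear_map class_ring U W T"
proof -
  interpret U: vectorspace class_ring U by (rule U)
  have mem: "T x \<in> carrier W" if "x \<in> carrier U" for x using that surj by blast
  have W: "vectorspace class_ring W"
  proof (rule vs_criteria)
    show "\<forall>v\<in>carrier W. \<exists>w\<in>carrier W. v \<oplus>\<^bsub>W\<^esub> w = \<zero>\<^bsub>W\<^esub>"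
    proof
      fix v assume "v \<in> carrier W"
      then obtain x where x: "x \<in> carrier U" "v = T x" using surj by blast
      then have "T x \<oplus>\<^bsub>W\<^esub> T (\<ominus>\<^bsub>U\<^esub> x) = \<zero>\<^bsub>W\<^esub>" by (simp add: add[symmetric] U.M.r_neg zero)
      then show "\<exists>w\<in>carrier W. v \<oplus>\<^bsub>W\<^esub> w = \<zero>\<^bsub>W\<^esub>" using x mem by auto
    qed
  qed (auto simp: surj[symmetric] class_field add[symmetric] smult[symmetric] zero[symmetric] U.M.a_ac
      U.smult_l_distr[simplified] U.smult_r_distr[simplified] U.smult_assoc1[simplified]
      U.smult_one[simplified])
  show "linear_map class_ring U W T"
    using U W add smult mem
    by (auto simp: linear_map_def vectorspace_def mod_hom_def mod_hom_axioms_def LinearCombinations.module_hom_def)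
qed

section \<open>Symmetric powers as spaces of polynomials\<close>

locale space_with_basis = vectorspace class_ring V
  for V :: "(complex, 'v) module" +
  fixes I :: "'i set" and e :: "'i \<Rightarrow> 'v" and coord :: "'v \<Rightarrow> 'i \<Rightarrow> complex"
  assumes finite_basis: "finite I"
    and e_closed: "k \<in> I \<Longrightarrow> e k \<in> carrier V"
    and coord_add: "x \<in> carrier V \<Longrightarrow> y \<in> carrier V \<Longrightarrow> k \<in> I \<Longrightarrow>
      coord (x \<oplus>\<^bsub>V\<^esub> y) k = coord x k + coord y k"
    and coord_smult: "x \<in> carrier V \<Longrightarrow> k \<in> I \<Longrightarrow> coord (c \<odot>\<^bsub>V\<^esub> x) k = c * coord x k"
    and coord_e: "j \<in> I \<Longrightarrow> k \<in> I \<Longrightarrow> coord (e j) k = (if j = k then 1 else 0)"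
    and span_e: "span (e ` I) = carrier V"
begin

text \<open>In the last case nothing is assumed about \<open>x\<close> when the scalar is \<open>0\<close>; that
  instance supplies the zero vector, even if the basis is empty.\<close>

lemma basis_induct [consumes 1, case_names basis add smult]:
  assumes "v \<in> carrier V"
    and "\<And>k. k \<in> I \<Longrightarrow> P (e k)"
    and "\<And>x y. x \<in> carrier V \<Longrightarrow> y \<in> carrier V \<Longrightarrow> P x \<Longrightarrow> P y \<Longrightarrow> P (x \<oplus>\<^bsub>V\<^esub> y)"
    and "\<And>c x. x \<in> carrier V \<Longrightarrow> c = 0 \<or> P x \<Longrightarrow> P (c \<odot>\<^bsub>V\<^esub> x)"
  shows "P v"
proof -
  have "P \<zero>\<^bsub>V\<^esub>" using assms(4)[of "\<zero>\<^bsub>V\<^esub>" 0] by simp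
  then have "submodule class_ring {x \<in> carrier V. P x} V"
    by (intro submodule.intro) (auto intro: assms module_axioms)
  moreover have "e ` I \<subseteq> {x \<in> carrier V. P x}" using assms(2) e_closed by auto
  ultimately have "span (e ` I) \<subseteq> {x \<in> carrier V. P x}" by (rule span_is_subset[rotated])
  then show ?thesis using assms(1) span_e by auto
qed

text \<open>Finitely supported functions on multisets form the polynomial ring with one
  variable per basis index: a multiset is a monomial. A vector becomes the linear
  form with the same coordinates.\<close>

definition linear_form :: "'v \<Rightarrow> ('i multiset \<Rightarrow>\<^sub>0 complex)" where
  "linear_form v = (\<Sum>k\<in>I. Poly_Mapping.single {#k#} (coord v k))"

lemma linear_form_add:
  "x \<in> carrier V \<Longrightarrow> y \<in> carrier V \<Longrightarrow> linear_form (x \<oplus>\<^bsub>V\<^esub> y) = linear_form x + linear_form y"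
  by (simp add: linear_form_def coord_add single_add sum.distrib)

lemma linear_form_smult:
  "x \<in> carrier V \<Longrightarrow> linear_form (c \<odot>\<^bsub>V\<^esub> x) = scale c (linear_form x)"
  by (simp add: linear_form_def coord_smult scale.scale_sum_right)

lemma linear_form_e: "k \<in> I \<Longrightarrow> linear_form (e k) = Poly_Mapping.single {#k#} 1"
proof -
  assume k: "k \<in> I"
  have "linear_form (e k) = (\<Sum>j\<in>I. if k = j then Poly_Mapping.single {#j#} 1 else 0)"
    unfolding linear_form_def using k by (intro sum.cong) (auto simp: coord_e)
  then show ?thesis using k finite_basis by simp
qed

definition product_form :: "'v list \<Rightarrow> ('i multiset \<Rightarrow>\<^sub>0 complex)" where
  "product_form us = prod_list (map linear_form us)"

lemma product_form_update:
  assumes "i < length us"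
  shows "product_form (us[i := x]) =
    linear_form x * (product_form (take i us) * product_form (drop (Suc i) us))"
  using assms by (simp add: product_form_def upd_conv_take_nth_drop mult_ac)

lemma product_form_basis:
  "set ks \<subseteq> I \<Longrightarrow> product_form (map e ks) = Poly_Mapping.single (mset ks) 1"
  by (induction ks) (auto simp: product_form_def linear_form_e mult_single)

abbreviation monomials :: "nat \<Rightarrow> 'i multiset set" where
  "monomials N \<equiv> {M. set_mset M \<subseteq> I \<and> size M = N}"

lemma keys_product_form:
  "Poly_Mapping.keys (product_form us) \<subseteq> monomials (length us)"
proof (induction us)
  case (Cons v us)
  have "M \<in> (\<lambda>k. {#k#}) ` I" if M: "M \<in> Poly_Mapping.keys (linear_form v)" for M
  proof (rule ccontr)
    assume "M \<notin> (\<lambda>k. {#k#}) ` I"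
    then have "Poly_Mapping.lookup (linear_form v) M = 0"
      by (auto simp: linear_form_def lookup_sum lookup_single when_def intro!: sum.neutral)
    with M show False by (simp add: in_keys_iff)
  qed
  moreover have "product_form (v # us) = linear_form v * product_form us"
    by (simp add: product_form_def)
  ultimately show ?case
    using keys_mult[of "linear_form v" "product_form us"] Cons.IH by fastforce
qed (simp add: product_form_def)

definition evaluate :: "('v list \<Rightarrow>\<^sub>0 complex) \<Rightarrow> ('i multiset \<Rightarrow>\<^sub>0 complex)" where
  "evaluate = lin_ext product_form"

definition basis_word :: "'i multiset \<Rightarrow> 'v list" where
  "basis_word M = map e (SOME ks. mset ks = M)"

lemma basis_wordE: obtains ks where "basis_word M = map e ks" "mset ks = M"
proof
  show "basis_word M = map e (SOME ks. mset ks = M)" by (rule basis_word_def)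
  show "mset (SOME ks. mset ks = M) = M" using ex_mset[of M] by (rule someI_ex)
qed

text \<open>A linear section of \<open>evaluate\<close>; which word of basis vectors represents a
  monomial is immaterial modulo the symmetry relations.\<close>

definition expand :: "('i multiset \<Rightarrow>\<^sub>0 complex) \<Rightarrow> ('v list \<Rightarrow>\<^sub>0 complex)" where
  "expand = lin_ext (\<lambda>M. gen (basis_word M))"

lemma basis_word_in_vec_lists: "M \<in> monomials N \<Longrightarrow> basis_word M \<in> vec_lists N V"
  using e_closed by (rule_tac basis_wordE[of M]) (auto simp: vec_lists_def)

lemma product_form_basis_word: "M \<in> monomials N \<Longrightarrow> product_form (basis_word M) = gen M"
  by (rule_tac basis_wordE[of M]) (auto simp: product_form_basis)

lemma keys_evaluate:
  "f \<in> carrier (free_space (vec_lists N V)) \<Longrightarrow> Poly_Mapping.keys (evaluate f) \<subseteq> monomials N"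
proof -
  have "Poly_Mapping.keys (product_form us) \<subseteq> monomials N" if "us \<in> vec_lists N V" for us
    using that keys_product_form[of us] by (simp add: vec_lists_def)
  then show "f \<in> carrier (free_space (vec_lists N V)) \<Longrightarrow> ?thesis"
    unfolding evaluate_def free_space_simps mem_Collect_eq by (rule keys_lin_ext[rotated])
qed

lemma expand_closed:
  "Poly_Mapping.keys p \<subseteq> monomials N \<Longrightarrow> expand p \<in> carrier (free_space (vec_lists N V))"
  unfolding expand_def free_space_simps mem_Collect_eq
  using basis_word_in_vec_lists by (intro keys_lin_ext[of p "monomials N"]) auto

lemma evaluate_expand:
  assumes "Poly_Mapping.keys p \<subseteq> monomials N"
  shows "evaluate (expand p) = p"
proof -
  have "evaluate (expand p) = lin_ext gen p"
    unfolding evaluate_def expand_def lin_ext_compose using assms product_form_basis_word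
    by (intro lin_ext_cong[of p "monomials N"]) auto
  also have "\<dots> = p"
    using assms by (induction p rule: free_space_induct) (simp_all add: lin_ext_add)
  finally show ?thesis .
qed

lemma vec_lists_update: "us \<in> vec_lists N V \<Longrightarrow> x \<in> carrier V \<Longrightarrow> us[i := x] \<in> vec_lists N V"
  by (auto simp: vec_lists_def dest!: subsetD[OF set_update_subset_insert])

lemma sym_relators_closed: "sym_relators N V \<subseteq> carrier (free_space (vec_lists N V))"
proof -
  have diff: "f - g \<in> carrier (free_space B)"
    if "f \<in> carrier (free_space B)" "g \<in> carrier (free_space B)" for f g and B :: "'v list set"
    using that keys_diff_subset[of f g] by auto
  have single: "Poly_Mapping.single us c \<in> carrier (free_space (vec_lists N V))"
    if "us \<in> vec_lists N V" for us c
    using that by auto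
  show ?thesis
    unfolding sym_relators_def
    by (auto simp del: free_space_simps intro!: diff single vec_lists_update)
qed

lemma sym_kernel_submodule: "submodule class_ring (sym_kernel N V) (free_space (vec_lists N V))"
proof -
  interpret F: vectorspace class_ring "free_space (vec_lists N V)" by (rule free_space_vectorspace)
  show ?thesis unfolding sym_kernel_def by (rule F.span_is_submodule[OF sym_relators_closed])
qed

lemma sym_relators_in_kernel: "sym_relators N V \<subseteq> sym_kernel N V"
proof -
  interpret F: vectorspace class_ring "free_space (vec_lists N V)" by (rule free_space_vectorspace)
  show ?thesis unfolding sym_kernel_def by (rule F.in_own_span[OF sym_relators_closed])
qed

lemma kernel_add: "f \<in> sym_kernel N V \<Longrightarrow> g \<in> sym_kernel N V \<Longrightarrow> f + g \<in> sym_kernel N V"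
  and kernel_scale: "f \<in> sym_kernel N V \<Longrightarrow> scale c f \<in> sym_kernel N V"
  and kernel_zero: "0 \<in> sym_kernel N V"
  using submodule.m_closed[OF sym_kernel_submodule] submodule.smult_closed[OF sym_kernel_submodule]
    submodule.zero_closed[OF sym_kernel_submodule]
  by auto

lemma kernel_closed: "f \<in> sym_kernel N V \<Longrightarrow> f \<in> carrier (free_space (vec_lists N V))"
  using submodule.subset[OF sym_kernel_submodule] by (rule subsetD)

text \<open>The relations hold because multiplication in the polynomial ring is bilinear
  and commutative.\<close>

lemma evaluate_relator: "f \<in> sym_relators N V \<Longrightarrow> evaluate f = 0"
proof -
  have len: "length us = N" if "us \<in> vec_lists N V" for us using that by (simp add: vec_lists_def)
  have perm: "product_form us = product_form ws" if "mset us = mset ws" for us ws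
    unfolding product_form_def by (metis mset_map prod_mset_prod_list that)
  have distrib: "scale c p * q = scale c (p * q)" for c and p q :: "'i multiset \<Rightarrow>\<^sub>0 complex"
    by (simp add: mult_map_scale_conv_mult mult_ac)
  assume "f \<in> sym_relators N V"
  then show ?thesis
    unfolding sym_relators_def
    by (auto simp: evaluate_def lin_ext_diff product_form_update len linear_form_add
        linear_form_smult distrib distrib_right intro: perm)
qed

lemma evaluate_kernel: "f \<in> sym_kernel N V \<Longrightarrow> evaluate f = 0"
proof -
  interpret F: vectorspace class_ring "free_space (vec_lists N V)" by (rule free_space_vectorspace)
  let ?Z = "{f \<in> carrier (free_space (vec_lists N V)). evaluate f = 0}"
  have "submodule class_ring ?Z (free_space (vec_lists N V))"
    using F.module_axioms F.M.add.m_closed F.smult_closed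
    by (intro submodule.intro) (auto simp: evaluate_def lin_ext_add lin_ext_scale)
  moreover have "sym_relators N V \<subseteq> ?Z"
    using sym_relators_closed evaluate_relator by blast
  ultimately have "sym_kernel N V \<subseteq> ?Z" unfolding sym_kernel_def by (rule F.span_is_subset[rotated])
  then show "f \<in> sym_kernel N V \<Longrightarrow> ?thesis" by blast
qed

text \<open>Modulo the relations every word is a combination of words in basis vectors:
  multilinearity expands one position after the other. A word in basis vectors is
  congruent to the chosen word with the same multiset of letters.\<close>

lemma expand_evaluate:
  assumes "f \<in> carrier (free_space (vec_lists N V))"
  shows "f - expand (evaluate f) \<in> sym_kernel N V"
proof -
  define T where "T f \<longleftrightarrow> f - expand (evaluate f) \<in> sym_kernel N V" for f
  have T_add: "T (f + g)" if "T f" "T g" for f g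
    using kernel_add[OF that[unfolded T_def]]
    by (simp add: T_def evaluate_def expand_def lin_ext_add algebra_simps)
  have T_scale: "T (scale c f)" if "T f" for c f
    using kernel_scale[OF that[unfolded T_def], of c]
    by (simp add: T_def evaluate_def expand_def lin_ext_scale scale.scale_right_diff_distrib)
  have T_kernel: "T f" if "f \<in> sym_kernel N V" for f
    using that by (simp add: T_def evaluate_kernel expand_def)
  \<comment> \<open>\<open>n\<close> bounds the positions that may still hold arbitrary vectors.\<close>
  have word: "T (gen us)" if "us \<in> vec_lists N V" "\<forall>i. n \<le> i \<and> i < N \<longrightarrow> us ! i \<in> e ` I" for us n
    using that
  proof (induction n arbitrary: us)
    case 0
    then have us: "set us \<subseteq> e ` I" by (auto simp: in_set_conv_nth vec_lists_def)
    define ks where "ks = map (inv_into I e) us"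
    have ks: "us = map e ks" "set ks \<subseteq> I"
      using us
      by (auto simp: ks_def f_inv_into_f subset_iff inv_into_into intro!: map_idI[symmetric])
    have M: "mset ks \<in> monomials N" using 0 ks by (auto simp: vec_lists_def)
    obtain ks' where ks': "basis_word (mset ks) = map e ks'" "mset ks' = mset ks" by (rule basis_wordE)
    have "mset us = mset (basis_word (mset ks))" using ks ks' by simp
    then have "gen us - gen (basis_word (mset ks)) \<in> sym_relators N V"
      using 0 basis_word_in_vec_lists[OF M] unfolding sym_relators_def by blast
    moreover have "expand (evaluate (gen us)) = gen (basis_word (mset ks))"
      using ks by (simp add: evaluate_def expand_def product_form_basis)
    ultimately show ?case using sym_relators_in_kernel by (auto simp: T_def)
  next
    case (Suc n)
    show ?case
    proof (cases "n < N")
      case False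
      then show ?thesis using Suc.prems by (intro Suc.IH) auto
    next
      case True
      have len: "length us = N" using Suc.prems by (simp add: vec_lists_def)
      have "T (gen (us[n := x]))" if "x \<in> carrier V" for x
        using that
      proof (induction x rule: basis_induct)
        case (basis k)
        then show ?case using Suc.prems True len e_closed
          by (intro Suc.IH vec_lists_update) (auto simp: nth_list_update)
      next
        case (add x y)
        have "gen (us[n := x \<oplus>\<^bsub>V\<^esub> y]) - gen (us[n := x]) - gen (us[n := y]) \<in> sym_kernel N V"
          using add.hyps Suc.prems True
          by (intro subsetD[OF sym_relators_in_kernel]) (auto simp: sym_relators_def)
        from T_add[OF T_kernel[OF this] T_add[OF add.IH]] show ?case by simp
      next
        case (smult c x)
        have "gen (us[n := c \<odot>\<^bsub>V\<^esub> x]) - scale c (gen (us[n := x])) \<in> sym_kernel N V"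
          using smult.hyps Suc.prems True
          by (intro subsetD[OF sym_relators_in_kernel]) (auto simp: sym_relators_def)
        moreover have "T (scale c (gen (us[n := x])))"
        proof (cases "c = 0")
          case True
          then show ?thesis by (simp add: T_kernel kernel_zero)
        next
          case False
          then show ?thesis using smult.IH by (intro T_scale) blast
        qed
        ultimately show ?case using T_add T_kernel by (metis diff_add_cancel)
      qed
      moreover have "us ! n \<in> carrier V" using True len Suc.prems by (auto simp: vec_lists_def)
      ultimately show ?thesis by (metis list_update_id)
    qed
  qed
  have "T f"
    using assms[simplified]
  proof (induction f rule: free_space_induct)
    case (single us c)
    then have "T (gen us)" by (intro word[of us N]) auto
    from T_scale[OF this, of c] show ?case by simp
  qed (auto simp: T_add T_kernel kernel_zero)
  then show ?thesis by (simp add: T_def)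
qed

text \<open>An element of the kernel of \<open>evaluate\<close> is congruent to the expansion of the
  zero polynomial.\<close>

lemma sym_kernel_iff:
  assumes "f \<in> carrier (free_space (vec_lists N V))"
  shows "f \<in> sym_kernel N V \<longleftrightarrow> evaluate f = 0"
  using expand_evaluate[OF assms] evaluate_kernel by (auto simp: expand_def)

end

section \<open>Weight spaces of symmetric powers\<close>

text \<open>The derivation of the polynomial ring whose value on the variable \<open>k\<close> is \<open>w k\<close>
  times that variable; a monomial is an eigenvector, with the sum of its weights as
  eigenvalue.\<close>

definition weight_scale :: "('i \<Rightarrow> complex) \<Rightarrow> ('i multiset \<Rightarrow>\<^sub>0 complex) \<Rightarrow> ('i multiset \<Rightarrow>\<^sub>0 complex)" where
  "weight_scale w = lin_ext (\<lambda>M. Poly_Mapping.single M (\<Sum>k\<in>#M. w k))"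

lemma lookup_weight_scale:
  "Poly_Mapping.lookup (weight_scale w p) M = (\<Sum>k\<in>#M. w k) * Poly_Mapping.lookup p M"
proof -
  have "Poly_Mapping.keys p \<subseteq> UNIV" by simp
  then show ?thesis
    by (induction p rule: free_space_induct)
      (auto simp: weight_scale_def lin_ext_add lookup_add lookup_single when_def algebra_simps)
qed

lemma weight_scale_add: "weight_scale w (p + q) = weight_scale w p + weight_scale w q"
  by (simp add: weight_scale_def lin_ext_add)

lemma weight_scale_mult:
  "weight_scale w (p * q) = weight_scale w p * q + p * weight_scale w q"
proof -
  have "Poly_Mapping.keys p \<subseteq> UNIV" "Poly_Mapping.keys q \<subseteq> UNIV" by simp_all
  then show ?thesis
  proof (induction p rule: free_space_induct)
    case (single M c)
    from single(2) show ?case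
    proof (induction q rule: free_space_induct)
      case (single M' c')
      have scale_single: "weight_scale w (Poly_Mapping.single L a) = Poly_Mapping.single L ((\<Sum>k\<in>#L. w k) * a)" for L a
        by (rule poly_mapping_eqI) (auto simp: lookup_weight_scale lookup_single when_def)
      show ?case
        unfolding mult_single scale_single single_add[symmetric] image_mset_union sum_mset.union
        by (simp only: distrib_left distrib_right mult.assoc mult.left_commute)
    next
      case (add f g)
      then show ?case by (simp add: distrib_left weight_scale_add)
    qed (simp add: weight_scale_def)
  next
    case (add f g)
    then show ?case by (simp add: distrib_right weight_scale_add)
  qed (simp add: weight_scale_def)
qed

lemma free_action_eq_lin_ext:
  "free_action \<rho> A f =
     lin_ext (\<lambda>us. \<Sum>i<length us. gen (us[i := \<rho> A (us ! i)])) f"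
  by (simp add: free_action_def lin_ext_def scale.scale_sum_right)

context space_with_basis
begin

text \<open>Leibniz rule: acting on one factor at a time is a derivation, and it is
  determined by its effect on linear forms.\<close>

lemma product_form_diagonal:
  assumes h: "\<And>x. x \<in> carrier V \<Longrightarrow> h x \<in> carrier V"
      "\<And>x k. x \<in> carrier V \<Longrightarrow> k \<in> I \<Longrightarrow> coord (h x) k = w k * coord x k"
    and "set us \<subseteq> carrier V"
  shows "(\<Sum>i<length us. product_form (us[i := h (us ! i)])) = weight_scale w (product_form us)"
  using assms(3)
proof (induction us)
  case Nil
  show ?case by (rule poly_mapping_eqI) (simp add: lookup_weight_scale product_form_def lookup_one when_def)
next
  case (Cons x us)
  have form: "linear_form (h x) = weight_scale w (linear_form x)"
  proof (rule poly_mapping_eqI)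
    fix M show "Poly_Mapping.lookup (linear_form (h x)) M = Poly_Mapping.lookup (weight_scale w (linear_form x)) M"
      using Cons.prems h
      by (auto simp: linear_form_def lookup_weight_scale lookup_sum lookup_single when_def
          sum_distrib_left intro!: sum.cong)
  qed
  have cons: "product_form (y # ys) = linear_form y * product_form ys" for y ys
    by (simp add: product_form_def)
  have "(\<Sum>i<length (x # us). product_form ((x # us)[i := h ((x # us) ! i)])) =
      linear_form (h x) * product_form us +
      linear_form x * (\<Sum>i<length us. product_form (us[i := h (us ! i)]))"
    by (simp add: sum.lessThan_Suc_shift cons sum_distrib_left del: sum.lessThan_Suc)
  also have "\<dots> = weight_scale w (product_form (x # us))"
    using Cons by (simp add: form cons weight_scale_mult)
  finally show ?case .
qed

lemma free_action_closed:
  assumes "\<And>x. x \<in> carrier V \<Longrightarrow> \<rho> A x \<in> carrier V"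
    and "f \<in> carrier (free_space (vec_lists N V))"
  shows "free_action \<rho> A f \<in> carrier (free_space (vec_lists N V))"
proof -
  have "Poly_Mapping.keys (\<Sum>i<length us. gen (us[i := \<rho> A (us ! i)])) \<subseteq> vec_lists N V"
    if us: "us \<in> vec_lists N V" for us
  proof (rule order_trans[OF keys_sum], safe)
    fix i vs' assume "i < length us" "vs' \<in> Poly_Mapping.keys (gen (us[i := \<rho> A (us ! i)]))"
    moreover from this(1) us have "us ! i \<in> carrier V" by (auto simp: vec_lists_def)
    ultimately show "vs' \<in> vec_lists N V" using us assms(1) by (auto intro: vec_lists_update)
  qed
  then show ?thesis
    using assms(2) unfolding free_action_eq_lin_ext free_space_simps mem_Collect_eq
    by (rule keys_lin_ext[rotated])
qed

text \<open>The induced action on the free space, seen through \<open>evaluate\<close>, is the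
  derivation that multiplies each monomial by its weight. In particular it preserves
  the relations.\<close>

lemma evaluate_free_action:
  assumes h: "\<And>x. x \<in> carrier V \<Longrightarrow> \<rho> A x \<in> carrier V"
      "\<And>x k. x \<in> carrier V \<Longrightarrow> k \<in> I \<Longrightarrow> coord (\<rho> A x) k = w k * coord x k"
    and f: "f \<in> carrier (free_space (vec_lists N V))"
  shows "evaluate (free_action \<rho> A f) = weight_scale w (evaluate f)"
proof -
  have sum: "lin_ext product_form (sum g S) = (\<Sum>i\<in>S. lin_ext product_form (g i))" for g :: "nat \<Rightarrow> _" and S
    by (induction S rule: infinite_finite_induct) (auto simp: lin_ext_add)
  have "evaluate (free_action \<rho> A f) =
      lin_ext (\<lambda>us. \<Sum>i<length us. product_form (us[i := \<rho> A (us ! i)])) f"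
    unfolding evaluate_def free_action_eq_lin_ext lin_ext_compose by (simp add: sum)
  also have "\<dots> = lin_ext (\<lambda>us. weight_scale w (product_form us)) f"
    using f product_form_diagonal[of "\<rho> A", OF h]
    by (intro lin_ext_cong[of f "vec_lists N V"]) (auto simp: vec_lists_def)
  also have "\<dots> = weight_scale w (evaluate f)"
    unfolding evaluate_def weight_scale_def lin_ext_compose ..
  finally show ?thesis .
qed

definition coset :: "nat \<Rightarrow> ('v list \<Rightarrow>\<^sub>0 complex) \<Rightarrow> ('v list \<Rightarrow>\<^sub>0 complex) set" where
  "coset N f = (\<lambda>k. k + f) ` sym_kernel N V"

lemma kernel_diff: "f \<in> sym_kernel N V \<Longrightarrow> g \<in> sym_kernel N V \<Longrightarrow> f - g \<in> sym_kernel N V"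
  using kernel_add[of f N "scale (-1) g"] kernel_scale[of g N "-1"] by simp

text \<open>The operations on cosets are defined by applying a map to all representatives
  and adding the kernel. The result is a single coset as soon as the map sends all
  representatives into one class.\<close>

lemma kernel_add_coset_image:
  assumes "\<And>k. k \<in> sym_kernel N V \<Longrightarrow> T (k + f) - g \<in> sym_kernel N V"
  shows "sym_kernel N V <+>\<^bsub>free_space (vec_lists N V)\<^esub> T ` coset N f = coset N g"
proof -
  have "sym_kernel N V <+>\<^bsub>free_space (vec_lists N V)\<^esub> T ` coset N f =
      {k + T (k' + f) | k k'. k \<in> sym_kernel N V \<and> k' \<in> sym_kernel N V}"
    by (auto simp: set_add_def set_mult_def coset_def)
  also have "\<dots> = coset N g"
  proof (intro equalityI subsetI)
    fix y assume "y \<in> {k + T (k' + f) | k k'. k \<in> sym_kernel N V \<and> k' \<in> sym_kernel N V}"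
    then obtain k k' where k: "y = k + T (k' + f)" "k \<in> sym_kernel N V" "k' \<in> sym_kernel N V" by blast
    have "y = (k + (T (k' + f) - g)) + g" using k by simp
    then show "y \<in> coset N g" using k assms kernel_add unfolding coset_def by blast
  next
    fix y assume "y \<in> coset N g"
    then obtain k where k: "y = k + g" "k \<in> sym_kernel N V" by (auto simp: coset_def)
    have "y = (k - (T (0 + f) - g)) + T (0 + f)" using k by simp
    then show "y \<in> {k + T (k' + f) | k k'. k \<in> sym_kernel N V \<and> k' \<in> sym_kernel N V}"
      using k assms kernel_diff kernel_zero by blast
  qed
  finally show ?thesis .
qed

lemma coset_eq_iff: "coset N f = coset N g \<longleftrightarrow> f - g \<in> sym_kernel N V"
proof
  assume "coset N f = coset N g"
  moreover have "0 + f \<in> coset N f" unfolding coset_def using kernel_zero by blast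
  ultimately obtain k where "k \<in> sym_kernel N V" "0 + f = k + g" unfolding coset_def by blast
  then show "f - g \<in> sym_kernel N V" by simp
next
  assume fg: "f - g \<in> sym_kernel N V"
  have "coset N f \<subseteq> coset N g" if "f - g \<in> sym_kernel N V" for f g
  proof
    fix y assume "y \<in> coset N f"
    then obtain k where "k \<in> sym_kernel N V" "y = (k + (f - g)) + g" by (auto simp: coset_def)
    then show "y \<in> coset N g" using that kernel_add unfolding coset_def by blast
  qed
  from this[OF fg] this[of g f] show "coset N f = coset N g"
    using kernel_diff[OF kernel_zero fg] by simp
qed

lemma sym_power_simps:
  "carrier (sym_power N V) = coset N ` carrier (free_space (vec_lists N V))"
  "\<zero>\<^bsub>sym_power N V\<^esub> = coset N 0"
  "coset N f \<oplus>\<^bsub>sym_power N V\<^esub> coset N g = coset N (f + g)"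
  "c \<odot>\<^bsub>sym_power N V\<^esub> coset N f = coset N (scale c f)"
proof -
  let ?K = "sym_kernel N V"
  show "carrier (sym_power N V) = coset N ` carrier (free_space (vec_lists N V))"
    by (auto simp: sym_power_def quotient_space_def A_RCOSETS_def' a_r_coset_def' coset_def)
  show "\<zero>\<^bsub>sym_power N V\<^esub> = coset N 0"
    by (simp add: sym_power_def quotient_space_def coset_def)
  show "c \<odot>\<^bsub>sym_power N V\<^esub> coset N f = coset N (scale c f)"
    unfolding sym_power_def quotient_space_def using kernel_scale
    by (simp add: kernel_add_coset_image scale.scale_right_distrib)
  have "coset N f \<oplus>\<^bsub>sym_power N V\<^esub> coset N g = {k + f + (k' + g) | k k'. k \<in> ?K \<and> k' \<in> ?K}"
    by (auto simp: sym_power_def quotient_space_def set_add_def set_mult_def coset_def)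
  also have "\<dots> = coset N (f + g)"
  proof (intro equalityI subsetI)
    fix y assume "y \<in> {k + f + (k' + g) | k k'. k \<in> ?K \<and> k' \<in> ?K}"
    then obtain k k' where "y = (k + k') + (f + g)" "k \<in> ?K" "k' \<in> ?K" by (auto simp: algebra_simps)
    then show "y \<in> coset N (f + g)" using kernel_add unfolding coset_def by blast
  next
    fix y assume "y \<in> coset N (f + g)"
    then obtain k where "k \<in> ?K" "y = k + f + (0 + g)" by (auto simp: coset_def algebra_simps)
    then show "y \<in> {k + f + (k' + g) | k k'. k \<in> ?K \<and> k' \<in> ?K}" using kernel_zero by blast
  qed
  finally show "coset N f \<oplus>\<^bsub>sym_power N V\<^esub> coset N g = coset N (f + g)" .
qed

lemma sym_action_coset:
  assumes h: "\<And>x. x \<in> carrier V \<Longrightarrow> \<rho> A x \<in> carrier V"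
      "\<And>x k. x \<in> carrier V \<Longrightarrow> k \<in> I \<Longrightarrow> coord (\<rho> A x) k = w k * coord x k"
    and f: "f \<in> carrier (free_space (vec_lists N V))"
  shows "sym_action N V \<rho> A (coset N f) = coset N (free_action \<rho> A f)"
  unfolding sym_action_def
proof (rule kernel_add_coset_image)
  fix k assume k: "k \<in> sym_kernel N V"
  have "free_action \<rho> A (k + f) - free_action \<rho> A f = free_action \<rho> A k"
    by (simp add: free_action_eq_lin_ext lin_ext_add)
  moreover have "evaluate (free_action \<rho> A k) = 0"
    using evaluate_free_action[of \<rho> A, OF h kernel_closed[OF k]] evaluate_kernel[OF k]
    by (simp add: weight_scale_def)
  ultimately show "free_action \<rho> A (k + f) - free_action \<rho> A f \<in> sym_kernel N V"
    using sym_kernel_iff[OF free_action_closed[of \<rho> A, OF h(1) kernel_closed[OF k]]] by simp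
qed

text \<open>A coset lies in the weight space exactly when its polynomial contains only
  monomials of weight \<open>\<mu>\<close>, so the section \<open>expand\<close> identifies the free space on
  these monomials with the weight space.\<close>

theorem weight_mult_sym_power:
  assumes closed: "\<And>H x. H \<in> cartan r \<Longrightarrow> x \<in> carrier V \<Longrightarrow> \<rho> H x \<in> carrier V"
    and diagonal: "\<And>H x k. H \<in> cartan r \<Longrightarrow> x \<in> carrier V \<Longrightarrow> k \<in> I \<Longrightarrow>
      coord (\<rho> H x) k = w H k * coord x k"
  shows "weight_mult r (sym_power N V) (sym_action N V \<rho>) \<mu> =
    card {M \<in> monomials N. \<forall>H\<in>cartan r. (\<Sum>k\<in>#M. w H k) = \<mu> H}"
proof -
  let ?F = "free_space (vec_lists N V)" and ?S = "sym_power N V"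
  define B where "B = {M \<in> monomials N. \<forall>H\<in>cartan r. (\<Sum>k\<in>#M. w H k) = \<mu> H}"
  define W where "W = weight_space r ?S (sym_action N V \<rho>) \<mu>"
  have finite_B: "finite B"
    unfolding B_def by (rule finite_subset[OF _ finite_multisets_of_size[OF finite_basis, of N]]) auto
  have eigen: "sym_action N V \<rho> H (coset N f) = \<mu> H \<odot>\<^bsub>?S\<^esub> coset N f \<longleftrightarrow>
      (\<forall>M\<in>Poly_Mapping.keys (evaluate f). (\<Sum>k\<in>#M. w H k) = \<mu> H)"
    if H: "H \<in> cartan r" and f: "f \<in> carrier ?F" for H f
  proof -
    interpret F: vectorspace class_ring ?F by (rule free_space_vectorspace)
    have act: "free_action \<rho> H f \<in> carrier ?F"
      using free_action_closed[of \<rho> H, OF closed[OF H] f] by simp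
    have "scale (\<mu> H) f \<in> carrier ?F" using F.smult_closed[OF _ f] by simp
    with act have diff: "free_action \<rho> H f - scale (\<mu> H) f \<in> carrier ?F"
      using keys_diff_subset[of "free_action \<rho> H f" "scale (\<mu> H) f"] by auto
    have "sym_action N V \<rho> H (coset N f) = \<mu> H \<odot>\<^bsub>?S\<^esub> coset N f \<longleftrightarrow>
        coset N (free_action \<rho> H f) = coset N (scale (\<mu> H) f)"
      using sym_action_coset[of \<rho> H, OF closed[OF H] diagonal[OF H] f] by (simp add: sym_power_simps)
    also have "\<dots> \<longleftrightarrow> evaluate (free_action \<rho> H f - scale (\<mu> H) f) = 0"
      unfolding coset_eq_iff by (rule sym_kernel_iff[OF diff])
    also have "\<dots> \<longleftrightarrow> weight_scale (w H) (evaluate f) = scale (\<mu> H) (evaluate f)"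
      using evaluate_free_action[of \<rho> H, OF closed[OF H] diagonal[OF H] f]
      by (simp add: evaluate_def lin_ext_diff lin_ext_scale)
    also have "\<dots> \<longleftrightarrow> (\<forall>M\<in>Poly_Mapping.keys (evaluate f). (\<Sum>k\<in>#M. w H k) = \<mu> H)"
      by (auto simp: poly_mapping_eq_iff fun_eq_iff lookup_weight_scale in_keys_iff)
    finally show ?thesis .
  qed
  have W: "W = coset N ` {f \<in> carrier ?F. Poly_Mapping.keys (evaluate f) \<subseteq> B}"
  proof -
    have "(\<forall>H\<in>cartan r. sym_action N V \<rho> H (coset N f) = \<mu> H \<odot>\<^bsub>?S\<^esub> coset N f) \<longleftrightarrow>
        Poly_Mapping.keys (evaluate f) \<subseteq> B" if f: "f \<in> carrier ?F" for f
      using keys_evaluate[OF f] by (auto simp: eigen[OF _ f] B_def)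
    then show ?thesis
      unfolding W_def weight_space_def sym_power_simps(1) by (auto simp del: free_space_simps)
  qed
  let ?T = "\<lambda>p. coset N (expand p)"
  have surj: "?T ` carrier (free_space B) = carrier (?S\<lparr>carrier := W\<rparr>)"
  proof -
    have "coset N f = ?T (evaluate f)" if "f \<in> carrier ?F" for f
      using expand_evaluate[OF that] by (simp add: coset_eq_iff)
    moreover have "expand p \<in> carrier ?F" "evaluate (expand p) = p" if "Poly_Mapping.keys p \<subseteq> B" for p
    proof -
      have "Poly_Mapping.keys p \<subseteq> monomials N" using that by (auto simp: B_def)
      then show "expand p \<in> carrier ?F" "evaluate (expand p) = p"
        by (rule expand_closed, rule evaluate_expand)
    qed
    ultimately have "coset N ` {f \<in> carrier ?F. Poly_Mapping.keys (evaluate f) \<subseteq> B} =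
        ?T ` {p. Poly_Mapping.keys p \<subseteq> B}"
      by (intro equalityI subsetI; elim imageE CollectE conjE) (metis (mono_tags, lifting) imageI mem_Collect_eq)+
    then show ?thesis unfolding W by simp
  qed
  have lin: "linear_map class_ring (free_space B) (?S\<lparr>carrier := W\<rparr>) ?T"
    using linear_map_onto[OF free_space_vectorspace surj]
    by (simp_all add: sym_power_simps expand_def lin_ext_add lin_ext_scale)
  have inj: "inj_on ?T (carrier (free_space B))"
  proof (rule inj_onI)
    fix p q assume pq: "p \<in> carrier (free_space B)" "q \<in> carrier (free_space B)" "?T p = ?T q"
    then have "evaluate (expand p) = evaluate (expand q)"
      using evaluate_kernel by (fastforce simp: coset_eq_iff evaluate_def lin_ext_diff)
    moreover have "evaluate (expand p) = p" "evaluate (expand q) = q"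
      using pq by (intro evaluate_expand[of _ N]; auto simp: B_def)+
    ultimately show "p = q" by simp
  qed
  interpret T: linear_map class_ring "free_space B" "?S\<lparr>carrier := W\<rparr>" ?T by (rule lin)
  have "vectorspace.dim class_ring (?S\<lparr>carrier := W\<rparr>) = card B"
    using T.dim_eq[OF free_space_basis(1)[OF finite_B] inj surj] free_space_basis(2)[OF finite_B] by simp
  then show ?thesis unfolding weight_mult_def W_def B_def .
qed

end

section \<open>Highest weight vectors of sl(2)\<close>

locale complex_space = vectorspace class_ring V for V :: "(complex, 'v) module"
begin

lemma zero_smult [simp]: "x \<in> carrier V \<Longrightarrow> 0 \<odot>\<^bsub>V\<^esub> x = \<zero>\<^bsub>V\<^esub>"
  and one_smult [simp]: "x \<in> carrier V \<Longrightarrow> 1 \<odot>\<^bsub>V\<^esub> x = x"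
  and smult_zero [simp]: "c \<odot>\<^bsub>V\<^esub> \<zero>\<^bsub>V\<^esub> = \<zero>\<^bsub>V\<^esub>"
  using smult_l_null[of x] smult_one[of x] smult_r_null[of c] by simp_all

lemma smult_eq_zeroD:
  assumes "c \<odot>\<^bsub>V\<^esub> v = \<zero>\<^bsub>V\<^esub>" "v \<in> carrier V" "c \<noteq> 0"
  shows "v = \<zero>\<^bsub>V\<^esub>"
proof -
  have "v = (inverse c * c) \<odot>\<^bsub>V\<^esub> v" using assms smult_one[simplified] by simp
  also have "\<dots> = inverse c \<odot>\<^bsub>V\<^esub> (c \<odot>\<^bsub>V\<^esub> v)" using assms smult_assoc1[of "inverse c" c v] by simp
  finally show ?thesis using assms(1) smult_r_null[of "inverse c"] by simp
qed

text \<open>If \<open>w\<close> were a combination of the other eigenvectors, applying \<open>T\<close> and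
  subtracting \<open>m w\<close> times the combination would give a relation among them with
  coefficients \<open>(m v - m w) a v\<close>.\<close>

lemma eigenvectors_lin_indpt:
  assumes T: "linear_map class_ring V V T" and "finite A" "A \<subseteq> carrier V" "\<zero>\<^bsub>V\<^esub> \<notin> A"
    and eigen: "\<And>v. v \<in> A \<Longrightarrow> T v = m v \<odot>\<^bsub>V\<^esub> v" and "inj_on m A"
  shows "lin_indpt A"
  using assms(2-)
proof (induction A rule: finite_induct)
  case empty
  show ?case by (simp add: lin_dep_def)
next
  case (insert w A)
  interpret T: linear_map class_ring V V T by (rule T)
  have A: "A \<subseteq> carrier V" "w \<in> carrier V" "lin_indpt A" using insert by auto
  have "w \<notin> span A"
  proof
    assume "w \<in> span A"
    then obtain a where a: "w = lincomb a A"
      using A insert.hyps by (auto simp: finite_span)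
    have "T w = (\<Oplus>\<^bsub>V\<^esub>v\<in>A. T (a v \<odot>\<^bsub>V\<^esub> v))"
      unfolding a(1) lincomb_def using A by (intro T.hom_sum) auto
    also have "\<dots> = lincomb (\<lambda>v. m v * a v) A"
      unfolding lincomb_def
    proof (rule M.finsum_cong')
      fix v assume v: "v \<in> A"
      then have "v \<in> carrier V" "T v = m v \<odot>\<^bsub>V\<^esub> v" using A insert.prems by auto
      then show "T (a v \<odot>\<^bsub>V\<^esub> v) = (m v * a v) \<odot>\<^bsub>V\<^esub> v"
        using smult_assoc1[of "a v" "m v" v] by (simp add: mult.commute)
    qed (use A in auto)
    finally have "T w = lincomb (\<lambda>v. m v * a v) A" .
    moreover have "T w = lincomb (\<lambda>v. m w * a v) A"
      using insert.prems a A lincomb_smult[of A a "m w"] by simp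
    ultimately have "lincomb (\<lambda>v. m v * a v - m w * a v) A = \<zero>\<^bsub>V\<^esub>"
      using lincomb_diff[of A "\<lambda>v. m v * a v" "\<lambda>v. m w * a v"] A insert.hyps
      by (simp add: class_ring_simps M.minus_eq M.r_neg)
    then have "m v * a v - m w * a v = 0" if "v \<in> A" for v
      using A(3) insert.hyps(1) that lin_dep_crit[of A A "\<lambda>v. m v * a v - m w * a v" v] by auto
    moreover have "m v \<noteq> m w" if "v \<in> A" for v
      using that insert.hyps insert.prems by (metis inj_onD insertCI)
    ultimately have "a \<in> A \<rightarrow> {0}" by (auto simp: left_diff_distrib[symmetric])
    then have "w = \<zero>\<^bsub>V\<^esub>" using a A lincomb_zero[of A a] by simp
    then show False using insert.prems by auto
  qed
  then show ?case using lin_dep_iff_in_span[of A w] A insert.hyps by simp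
qed

text \<open>Let \<open>u\<^sub>n = F\<^sup>n v\<close>. Then \<open>H u\<^sub>n = (l - 2n) u\<^sub>n\<close> and \<open>E u\<^sub>n\<^sub>+\<^sub>1 = (n + 1)(l - n)
  u\<^sub>n\<close>. The last scalar vanishes only for \<open>n = l\<close>, so if \<open>u\<^sub>l\<^sub>+\<^sub>1\<close> is nonzero then
  so are all later \<open>u\<^sub>n\<close>; their \<open>H\<close>-eigenvalues are distinct, which is impossible in
  finite dimension.\<close>

lemma sl2_lowering_power_vanishes:
  fixes l :: nat
  assumes fd: fin_dim
    and T: "linear_map class_ring V V E" "linear_map class_ring V V F" "linear_map class_ring V V H"
    and EF: "\<And>x. x \<in> carrier V \<Longrightarrow> E (F x) = H x \<oplus>\<^bsub>V\<^esub> F (E x)"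
    and HF: "\<And>x. x \<in> carrier V \<Longrightarrow> H (F x) = (-2) \<odot>\<^bsub>V\<^esub> F x \<oplus>\<^bsub>V\<^esub> F (H x)"
    and v: "v \<in> carrier V" "E v = \<zero>\<^bsub>V\<^esub>" "H v = of_nat l \<odot>\<^bsub>V\<^esub> v"
  shows "(F ^^ Suc l) v = \<zero>\<^bsub>V\<^esub>"
proof (rule ccontr)
  interpret E: linear_map class_ring V V E by (rule T)
  interpret F: linear_map class_ring V V F by (rule T)
  interpret H: linear_map class_ring V V H by (rule T)
  define u where "u n = (F ^^ n) v" for n
  have mem: "x \<in> carrier V \<Longrightarrow> F x \<in> carrier V" for x
    using module_hom_closed[OF F.f_hom] by auto
  have u: "u n \<in> carrier V" for n by (induction n) (auto simp: u_def v mem)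
  have u_Suc: "u (Suc n) = F (u n)" for n by (simp add: u_def)
  have smult_add: "(a + b) \<odot>\<^bsub>V\<^esub> x = a \<odot>\<^bsub>V\<^esub> x \<oplus>\<^bsub>V\<^esub> b \<odot>\<^bsub>V\<^esub> x" if "x \<in> carrier V" for a b x
    using smult_l_distr[of a b x] that by simp
  have H_u: "H (u n) = (of_nat l - 2 * of_nat n) \<odot>\<^bsub>V\<^esub> u n" for n
  proof (induction n)
    case 0
    show ?case using v by (simp add: u_def)
  next
    case (Suc n)
    have "H (u (Suc n)) = (-2) \<odot>\<^bsub>V\<^esub> F (u n) \<oplus>\<^bsub>V\<^esub> (of_nat l - 2 * of_nat n) \<odot>\<^bsub>V\<^esub> F (u n)"
      using u by (simp add: u_Suc HF Suc)
    also have "\<dots> = (of_nat l - 2 * of_nat (Suc n)) \<odot>\<^bsub>V\<^esub> u (Suc n)"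
      using u mem by (simp add: u_Suc smult_add[symmetric] algebra_simps)
    finally show ?case .
  qed
  have E_u: "E (u (Suc n)) = (of_nat (Suc n) * (of_nat l - of_nat n)) \<odot>\<^bsub>V\<^esub> u n" for n
  proof (induction n)
    case 0
    show ?case using v by (simp add: u_def EF)
  next
    case (Suc n)
    have "E (u (Suc (Suc n))) = H (u (Suc n)) \<oplus>\<^bsub>V\<^esub> F (E (u (Suc n)))"
      using u by (simp add: u_Suc[of "Suc n"] EF)
    also have "\<dots> = (of_nat l - 2 * of_nat (Suc n)) \<odot>\<^bsub>V\<^esub> u (Suc n) \<oplus>\<^bsub>V\<^esub>
        (of_nat (Suc n) * (of_nat l - of_nat n)) \<odot>\<^bsub>V\<^esub> u (Suc n)"
      using u by (simp only: H_u Suc F.f_smult class_ring_simps) (simp add: u_Suc)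
    also have "\<dots> = (of_nat (Suc (Suc n)) * (of_nat l - of_nat (Suc n))) \<odot>\<^bsub>V\<^esub> u (Suc n)"
      unfolding smult_add[OF u, symmetric] by (simp add: algebra_simps)
    finally show ?case .
  qed
  assume "(F ^^ Suc l) v \<noteq> \<zero>\<^bsub>V\<^esub>"
  then have "u (Suc l) \<noteq> \<zero>\<^bsub>V\<^esub>" by (simp add: u_def)
  then have nonzero: "u (Suc l + n) \<noteq> \<zero>\<^bsub>V\<^esub>" for n
  proof (induction n)
    case (Suc n)
    show ?case
    proof
      assume "u (Suc l + Suc n) = \<zero>\<^bsub>V\<^esub>"
      then have "(of_nat (Suc (Suc l + n)) * (of_nat l - of_nat (Suc l + n))) \<odot>\<^bsub>V\<^esub> u (Suc l + n) = \<zero>\<^bsub>V\<^esub>"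
        using E_u[of "Suc l + n"] by simp
      moreover have "complex_of_nat (Suc (Suc l + n)) * (of_nat l - of_nat (Suc l + n)) \<noteq> 0"
        by (metis add_Suc add_Suc_right eq_iff_diff_eq_0 less_add_Suc1 mult_eq_0_iff nat_neq_iff of_nat_eq_0_iff of_nat_eq_iff old.nat.distinct(2))
      ultimately show False using smult_eq_zeroD[OF _ u] Suc by auto
    qed
  qed simp
  \<comment> \<open>One vector more than the dimension; \<open>m\<close> reads the eigenvalue off a vector.\<close>
  let ?A = "(\<lambda>n. u (Suc l + n)) ` {..dim}"
  define m where "m x = (SOME c. H x = c \<odot>\<^bsub>V\<^esub> x)" for x
  have unique: "c = d" if "c \<odot>\<^bsub>V\<^esub> x = d \<odot>\<^bsub>V\<^esub> x" "x \<in> carrier V" "x \<noteq> \<zero>\<^bsub>V\<^esub>" for c d x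
  proof (rule ccontr)
    assume "c \<noteq> d"
    have "(c - d) \<odot>\<^bsub>V\<^esub> x \<oplus>\<^bsub>V\<^esub> d \<odot>\<^bsub>V\<^esub> x = d \<odot>\<^bsub>V\<^esub> x"
      using that by (simp add: smult_add[symmetric])
    then have "(c - d) \<odot>\<^bsub>V\<^esub> x = \<zero>\<^bsub>V\<^esub>" using that by (simp add: M.add.r_cancel_one)
    then show False using smult_eq_zeroD that \<open>c \<noteq> d\<close> by fastforce
  qed
  have m: "m (u (Suc l + n)) = of_nat l - 2 * of_nat (Suc l + n)" for n
  proof -
    have "H (u (Suc l + n)) = m (u (Suc l + n)) \<odot>\<^bsub>V\<^esub> u (Suc l + n)"
      unfolding m_def using H_u by (rule someI)
    then show ?thesis using H_u unique nonzero u by metis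
  qed
  have inj: "inj (\<lambda>n. m (u (Suc l + n)))" unfolding m by (rule injI) simp
  then have inj_u: "inj (\<lambda>n. u (Suc l + n))" by (auto simp: inj_def)
  have "lin_indpt ?A"
  proof (rule eigenvectors_lin_indpt[OF T(3)])
    show "H x = m x \<odot>\<^bsub>V\<^esub> x" if "x \<in> ?A" for x using that H_u m by auto
    show "inj_on m ?A" using inj by (auto simp: inj_on_def inj_def)
    show "\<zero>\<^bsub>V\<^esub> \<notin> ?A" using nonzero by (metis (no_types, lifting) imageE)
  qed (use u in auto)
  then have "card ?A \<le> dim" using fd u by (intro li_le_dim(2)) auto
  moreover have "card ?A = Suc dim" using inj_u by (simp add: card_image inj_on_subset[of _ UNIV])
  ultimately show False by simp
qed

end

section \<open>Matrix units and representations of sl(r+1)\<close>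

definition mat_unit :: "nat \<Rightarrow> nat \<Rightarrow> nat \<Rightarrow> complex mat" where
  "mat_unit r i j = mat (r + 1) (r + 1) (\<lambda>(a, b). if a = i \<and> b = j then 1 else 0)"

lemma mat_unit_carrier [simp]: "mat_unit r i j \<in> carrier_mat (Suc r) (Suc r)"
  by (simp add: mat_unit_def)

lemma mat_unit_index [simp]:
  "a \<le> r \<Longrightarrow> b \<le> r \<Longrightarrow> mat_unit r i j $$ (a, b) = (if a = i \<and> b = j then 1 else 0)"
  "dim_row (mat_unit r i j) = Suc r" "dim_col (mat_unit r i j) = Suc r"
  by (simp_all add: mat_unit_def)

lemma mat_unit_mult_index:
  assumes A: "A \<in> carrier_mat (r + 1) (r + 1)" and "i \<le> r" "j \<le> r" "a \<le> r" "b \<le> r"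
  shows "(mat_unit r i j * A) $$ (a, b) = (if a = i then A $$ (j, b) else 0)"
    "(A * mat_unit r i j) $$ (a, b) = (if b = j then A $$ (a, i) else 0)"
proof -
  have delta: "(if P then 1 else 0) * x = (if P then x else 0)"
    "x * (if P then 1 else 0) = (if P then x else 0)" for P and x :: complex
    by simp_all
  show "(mat_unit r i j * A) $$ (a, b) = (if a = i then A $$ (j, b) else 0)"
    "(A * mat_unit r i j) $$ (a, b) = (if b = j then A $$ (a, i) else 0)"
    using assms
    by (auto simp: scalar_prod_def atLeast0LessThan delta less_Suc_eq_le simp del: sum.lessThan_Suc)
qed

lemma mat_unit_in_sl:
  assumes "i \<noteq> j" shows "mat_unit r i j \<in> sl (r + 1)"
proof -
  have "(\<Sum>k<r + 1. mat_unit r i j $$ (k, k)) = 0"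
    using assms by (intro sum.neutral) auto
  then show ?thesis by (simp add: sl_def del: sum.lessThan_Suc)
qed

text \<open>The commutator of the matrix units at \<open>(i, j)\<close> and \<open>(j, i)\<close>.\<close>

definition diag_diff :: "nat \<Rightarrow> nat \<Rightarrow> nat \<Rightarrow> complex mat" where
  "diag_diff r i j = mat_unit r i i - mat_unit r j j"

lemma diag_diff_cartan:
  assumes "i \<le> r" "j \<le> r" shows "diag_diff r i j \<in> cartan r"
proof -
  have "(\<Sum>k<r + 1. diag_diff r i j $$ (k, k)) = (\<Sum>k<r + 1. (if k = i then 1 else 0) - (if k = j then 1 else 0))"
    by (rule sum.cong) (auto simp: diag_diff_def)
  also have "\<dots> = 0" using assms by (simp add: sum_subtractf)
  finally show ?thesis by (auto simp: cartan_def sl_def diagonal_mat_def diag_diff_def)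
qed

lemma diag_diff_index: "k \<le> r \<Longrightarrow> diag_diff r i j $$ (k, k) = (if k = i then 1 else 0) - (if k = j then 1 else 0)"
  by (simp add: diag_diff_def)

lemma cartan_in_sl: "H \<in> cartan r \<Longrightarrow> H \<in> sl (r + 1)"
  by (simp add: cartan_def)

lemma sl_add_smult:
  assumes "A \<in> sl n" "B \<in> sl n" shows "A + c \<cdot>\<^sub>m B \<in> sl n"
proof -
  have "(\<Sum>i<n. (A + c \<cdot>\<^sub>m B) $$ (i, i)) = (\<Sum>i<n. A $$ (i, i) + c * B $$ (i, i))"
    using assms by (intro sum.cong) (auto simp: sl_def)
  also have "\<dots> = (\<Sum>i<n. A $$ (i, i)) + c * (\<Sum>i<n. B $$ (i, i))"
    by (simp add: sum.distrib sum_distrib_left)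
  finally show ?thesis using assms by (simp add: sl_def)
qed

text \<open>A traceless matrix arises from a diagonal one by adding its off-diagonal
  entries one by one, and all intermediate matrices stay traceless. The induction is
  on the number of nonzero off-diagonal entries.\<close>

lemma sl_induct [consumes 1, case_names cartan mat_unit]:
  assumes "A \<in> sl (r + 1)"
    and cartan: "\<And>H. H \<in> cartan r \<Longrightarrow> P H"
    and unit: "\<And>A i j c. A \<in> sl (r + 1) \<Longrightarrow> P A \<Longrightarrow> i \<le> r \<Longrightarrow> j \<le> r \<Longrightarrow> i \<noteq> j \<Longrightarrow>
      P (A + c \<cdot>\<^sub>m mat_unit r i j)"
  shows "P A"
proof -
  let ?S = "\<lambda>A. {(i, j) \<in> {..r} \<times> {..r}. i \<noteq> j \<and> A $$ (i, j) \<noteq> (0::complex)}"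
  show ?thesis using assms(1)
  proof (induction "card (?S A)" arbitrary: A)
    case 0
    have "finite (?S A)" by (rule finite_subset[of _ "{..r} \<times> {..r}"]) auto
    with 0 have "?S A = {}" by (metis (no_types, lifting) card_eq_0_iff)
    then have "A $$ (i, j) = 0" if "i \<le> r" "j \<le> r" "i \<noteq> j" for i j using that by blast
    then have "A \<in> cartan r"
      using 0 by (auto simp: cartan_def diagonal_mat_def sl_def less_Suc_eq_le simp del: card_0_eq)
    then show ?case by (rule cartan)
  next
    case (Suc n)
    then obtain i j where ij: "(i, j) \<in> ?S A" by (metis (no_types, lifting) card.empty ex_in_conv old.prod.exhaust nat.distinct(1))
    define c where "c = A $$ (i, j)"
    define B where "B = A + (- c) \<cdot>\<^sub>m mat_unit r i j"
    have B: "B \<in> sl (r + 1)" unfolding B_def using Suc.prems ij by (intro sl_add_smult mat_unit_in_sl) auto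
    have fin: "finite (?S A)" by (rule finite_subset[of _ "{..r} \<times> {..r}"]) auto
    have "?S B = ?S A - {(i, j)}"
      using Suc.prems by (auto simp: B_def c_def sl_def split: if_splits)
    then have "card (?S B) = n" using ij Suc.hyps(2) fin by (simp add: card_Diff_singleton)
    then have "P (B + c \<cdot>\<^sub>m mat_unit r i j)" using ij B Suc.hyps(1) by (intro unit) auto
    moreover have "B + c \<cdot>\<^sub>m mat_unit r i j = A"
      using Suc.prems by (intro eq_matI) (auto simp: B_def sl_def)
    ultimately show ?case by simp
  qed
qed

locale sl_representation = complex_space V for V :: "(complex, 'v) module" +
  fixes r :: nat and \<rho> :: "complex mat \<Rightarrow> 'v \<Rightarrow> 'v"
  assumes rep: "sl_rep r V \<rho>"
begin

lemma rep_linear: "A \<in> sl (r + 1) \<Longrightarrow> linear_map class_ring V V (\<rho> A)"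
  using rep by (simp add: sl_rep_def)

lemma rep_closed: "A \<in> sl (r + 1) \<Longrightarrow> x \<in> carrier V \<Longrightarrow> \<rho> A x \<in> carrier V"
  using rep_linear[of A] module_hom_closed[OF mod_hom.f_hom[OF linear_map.axioms(3)]] by fastforce

lemma rep_vec_add: "A \<in> sl (r + 1) \<Longrightarrow> x \<in> carrier V \<Longrightarrow> y \<in> carrier V \<Longrightarrow>
    \<rho> A (x \<oplus>\<^bsub>V\<^esub> y) = \<rho> A x \<oplus>\<^bsub>V\<^esub> \<rho> A y"
  using rep_linear[of A] by (simp add: linear_map.T_add)

lemma rep_vec_smult:
  "A \<in> sl (r + 1) \<Longrightarrow> x \<in> carrier V \<Longrightarrow> \<rho> A (c \<odot>\<^bsub>V\<^esub> x) = c \<odot>\<^bsub>V\<^esub> \<rho> A x"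
  using rep_linear[of A] by (simp add: linear_map.T_smult)

lemma rep_vec_zero: "A \<in> sl (r + 1) \<Longrightarrow> \<rho> A \<zero>\<^bsub>V\<^esub> = \<zero>\<^bsub>V\<^esub>"
  using rep_vec_smult[of A "\<zero>\<^bsub>V\<^esub>" 0] rep_closed by simp

lemma rep_mat_add_smult:
  assumes "A \<in> sl (r + 1)" "B \<in> sl (r + 1)" "x \<in> carrier V"
  shows "\<rho> (A + c \<cdot>\<^sub>m B) x = \<rho> A x \<oplus>\<^bsub>V\<^esub> c \<odot>\<^bsub>V\<^esub> \<rho> B x"
proof -
  have "c \<cdot>\<^sub>m B \<in> sl (r + 1)"
    using sl_add_smult[of "0\<^sub>m (r + 1) (r + 1)" "r + 1" B c] assms
    by (simp add: sl_def)
  then show ?thesis using rep assms by (simp add: sl_rep_def)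
qed

lemma rep_bracket:
  assumes "A \<in> sl (r + 1)" "B \<in> sl (r + 1)" "x \<in> carrier V"
  shows "\<rho> A (\<rho> B x) = \<rho> (A * B - B * A) x \<oplus>\<^bsub>V\<^esub> \<rho> B (\<rho> A x)"
proof -
  have "\<rho> (A * B - B * A) x = \<rho> A (\<rho> B x) \<ominus>\<^bsub>V\<^esub> \<rho> B (\<rho> A x)"
    using rep assms by (simp add: sl_rep_def)
  moreover have "\<rho> A (\<rho> B x) \<in> carrier V" "\<rho> B (\<rho> A x) \<in> carrier V" using assms rep_closed by auto
  ultimately show ?thesis by (simp add: M.minus_eq M.a_assoc M.l_neg)
qed

lemma rep_cartan_unit:
  assumes "H \<in> cartan r" "i \<le> r" "j \<le> r" "i \<noteq> j" "x \<in> carrier V"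
  shows "\<rho> H (\<rho> (mat_unit r i j) x) =
    (H $$ (i, i) - H $$ (j, j)) \<odot>\<^bsub>V\<^esub> \<rho> (mat_unit r i j) x \<oplus>\<^bsub>V\<^esub> \<rho> (mat_unit r i j) (\<rho> H x)"
proof -
  have H: "H \<in> carrier_mat (r + 1) (r + 1)" using assms by (simp add: cartan_def sl_def)
  have "H * mat_unit r i j - mat_unit r i j * H = (H $$ (i, i) - H $$ (j, j)) \<cdot>\<^sub>m mat_unit r i j"
    using H assms
    by (intro eq_matI)
      (auto simp: mat_unit_mult_index simp del: index_mult_mat(1), auto simp: cartan_def diagonal_mat_def)
  moreover have "\<rho> (c \<cdot>\<^sub>m mat_unit r i j) x = c \<odot>\<^bsub>V\<^esub> \<rho> (mat_unit r i j) x" for c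
    using rep assms mat_unit_in_sl[of i j r] by (simp add: sl_rep_def)
  ultimately show ?thesis
    using rep_bracket[of H "mat_unit r i j" x] assms cartan_in_sl mat_unit_in_sl by simp
qed

text \<open>The relation \<open>[E\<^sub>i\<^sub>j, E\<^sub>k\<^sub>l] = \<delta>\<^sub>j\<^sub>k E\<^sub>i\<^sub>l - \<delta>\<^sub>i\<^sub>l E\<^sub>k\<^sub>j\<close>, split into the four
  cases so that every matrix that occurs is traceless and hence within reach of the
  representation.\<close>

lemma rep_unit_unit:
  assumes "i \<le> r" "j \<le> r" "k \<le> r" "l \<le> r" "i \<noteq> j" "k \<noteq> l" "x \<in> carrier V"
  defines "E \<equiv> \<lambda>i j. \<rho> (mat_unit r i j)"
  shows "j \<noteq> k \<Longrightarrow> i \<noteq> l \<Longrightarrow> E i j (E k l x) = E k l (E i j x)"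
    and "j = k \<Longrightarrow> i \<noteq> l \<Longrightarrow> E i j (E k l x) = E i l x \<oplus>\<^bsub>V\<^esub> E k l (E i j x)"
    and "j \<noteq> k \<Longrightarrow> i = l \<Longrightarrow> E i j (E k l x) = (-1) \<odot>\<^bsub>V\<^esub> E k j x \<oplus>\<^bsub>V\<^esub> E k l (E i j x)"
    and "j = k \<Longrightarrow> i = l \<Longrightarrow> E i j (E k l x) = \<rho> (diag_diff r i j) x \<oplus>\<^bsub>V\<^esub> E k l (E i j x)"
proof -
  let ?A = "mat_unit r i j" and ?B = "mat_unit r k l"
  let ?C = "?A * ?B - ?B * ?A"
  have bracket: "E i j (E k l x) = \<rho> ?C x \<oplus>\<^bsub>V\<^esub> E k l (E i j x)"
    unfolding E_def using assms mat_unit_in_sl by (intro rep_bracket) auto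
  have smult: "\<rho> (c \<cdot>\<^sub>m mat_unit r a b) x = c \<odot>\<^bsub>V\<^esub> \<rho> (mat_unit r a b) x" if "a \<noteq> b" for a b c
    using rep assms mat_unit_in_sl[OF that] by (simp add: sl_rep_def)
  have index: "?C $$ (a, b) = (if a = i \<and> j = k \<and> b = l then 1 else 0) - (if a = k \<and> l = i \<and> b = j then 1 else 0)"
    if "a \<le> r" "b \<le> r" for a b
    using that assms by (simp add: mat_unit_mult_index del: index_mult_mat(1))
  have mem: "E a b y \<in> carrier V" if "a \<noteq> b" "y \<in> carrier V" for a b y
    unfolding E_def using that rep_closed mat_unit_in_sl by auto
  show "E i j (E k l x) = E k l (E i j x)" if "j \<noteq> k" "i \<noteq> l"
  proof -
    have "?C = 0 \<cdot>\<^sub>m ?A" using that index by (intro eq_matI) auto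
    then show ?thesis using bracket smult mem assms by (simp add: E_def)
  qed
  show "E i j (E k l x) = E i l x \<oplus>\<^bsub>V\<^esub> E k l (E i j x)" if "j = k" "i \<noteq> l"
  proof -
    have "?C = mat_unit r i l" using that index by (intro eq_matI) auto
    then show ?thesis using bracket by (simp add: E_def)
  qed
  show "E i j (E k l x) = (-1) \<odot>\<^bsub>V\<^esub> E k j x \<oplus>\<^bsub>V\<^esub> E k l (E i j x)" if "j \<noteq> k" "i = l"
  proof -
    have "?C = (-1) \<cdot>\<^sub>m mat_unit r k j" using that index by (intro eq_matI) auto
    then show ?thesis using bracket smult that by (simp add: E_def)
  qed
  show "E i j (E k l x) = \<rho> (diag_diff r i j) x \<oplus>\<^bsub>V\<^esub> E k l (E i j x)" if "j = k" "i = l"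
  proof -
    have "?C = diag_diff r i j" using that index by (intro eq_matI) (auto simp: diag_diff_def)
    then show ?thesis using bracket by simp
  qed
qed

end

section \<open>The first fundamental representation\<close>

text \<open>The weight of \<open>v0\<close> is \<open>\<omega>\<^sub>1\<close>, which reads off the upper left entry.\<close>

locale first_fundamental = sl_representation V r \<rho>
  for V :: "(complex, 'v) module" and r \<rho> +
  fixes v0 :: 'v
  assumes r: "r \<ge> 1"
    and irreducible: "irreducible_sl_rep r V \<rho>"
    and v0_closed: "v0 \<in> carrier V" and v0_nonzero: "v0 \<noteq> \<zero>\<^bsub>V\<^esub>"
    and v0_weight: "H \<in> cartan r \<Longrightarrow> \<rho> H v0 = H $$ (0, 0) \<odot>\<^bsub>V\<^esub> v0"
    and v0_highest: "A \<in> strictly_upper r \<Longrightarrow> \<rho> A v0 = \<zero>\<^bsub>V\<^esub>"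
begin

abbreviation E :: "nat \<Rightarrow> nat \<Rightarrow> 'v \<Rightarrow> 'v" where
  "E i j \<equiv> \<rho> (mat_unit r i j)"

lemma E_closed [simp]: "i \<noteq> j \<Longrightarrow> x \<in> carrier V \<Longrightarrow> E i j x \<in> carrier V"
  using rep_closed[OF mat_unit_in_sl] .

lemma E_zero [simp]: "i \<noteq> j \<Longrightarrow> E i j \<zero>\<^bsub>V\<^esub> = \<zero>\<^bsub>V\<^esub>"
  using rep_vec_zero[OF mat_unit_in_sl] .

lemma E_raise_v0: "i < j \<Longrightarrow> E i j v0 = \<zero>\<^bsub>V\<^esub>"
  by (rule v0_highest) (auto simp: strictly_upper_def)

text \<open>The matrix units at \<open>(j, i)\<close> and \<open>(i, j)\<close> span a copy of \<open>sl(2)\<close> for which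
  \<open>v0\<close> is a highest weight vector, of weight \<open>1\<close> if \<open>j = 0\<close> and \<open>0\<close> otherwise.\<close>

lemma E_lower_power_v0:
  assumes "j < i" "i \<le> r"
  shows "(E i j ^^ Suc (if j = 0 then 1 else 0)) v0 = \<zero>\<^bsub>V\<^esub>"
proof (rule sl2_lowering_power_vanishes)
  show fin_dim using rep by (simp add: sl_rep_def)
  show "linear_map class_ring V V (E j i)" "linear_map class_ring V V (E i j)"
    using assms by (auto intro!: rep_linear mat_unit_in_sl)
  show "linear_map class_ring V V (\<rho> (diag_diff r j i))"
    using assms by (intro rep_linear cartan_in_sl diag_diff_cartan) auto
  show "E j i (E i j x) = \<rho> (diag_diff r j i) x \<oplus>\<^bsub>V\<^esub> E i j (E j i x)" if "x \<in> carrier V" for x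
    using assms that by (intro rep_unit_unit(4)) auto
  show "\<rho> (diag_diff r j i) (E i j x) = (-2) \<odot>\<^bsub>V\<^esub> E i j x \<oplus>\<^bsub>V\<^esub> E i j (\<rho> (diag_diff r j i) x)"
    if "x \<in> carrier V" for x
    using rep_cartan_unit[of "diag_diff r j i" i j x] assms that
    by (simp add: diag_diff_cartan diag_diff_index)
  show "\<rho> (diag_diff r j i) v0 = of_nat (if j = 0 then 1 else 0) \<odot>\<^bsub>V\<^esub> v0"
    using assms by (simp add: v0_weight diag_diff_cartan diag_diff_index)
qed (use assms v0_closed E_raise_v0 in auto)

lemma E_v0: "i \<le> r \<Longrightarrow> j \<le> r \<Longrightarrow> i \<noteq> j \<Longrightarrow> j \<noteq> 0 \<Longrightarrow> E i j v0 = \<zero>\<^bsub>V\<^esub>"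
  using E_raise_v0[of i j] E_lower_power_v0[of j i] by (cases "i < j") auto

text \<open>For \<open>i \<noteq> k\<close>, apply \<open>E\<^sub>i\<^sub>k\<close> to \<open>E\<^sub>k\<^sub>0 E\<^sub>k\<^sub>0 v\<^sub>0 = 0\<close>: moving \<open>E\<^sub>i\<^sub>k\<close> to the
  right, where it kills \<open>v\<^sub>0\<close>, leaves \<open>2 E\<^sub>i\<^sub>0 E\<^sub>k\<^sub>0 v\<^sub>0\<close>.\<close>

lemma E_lower_lower_v0:
  assumes "i \<le> r" "k \<le> r" "i \<noteq> 0" "k \<noteq> 0"
  shows "E i 0 (E k 0 v0) = \<zero>\<^bsub>V\<^esub>"
proof (cases "i = k")
  case True
  then show ?thesis using E_lower_power_v0[of 0 k] assms by simp
next
  case False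
  have "E i k (E k 0 v0) = E i 0 v0 \<oplus>\<^bsub>V\<^esub> E k 0 (E i k v0)"
    using assms False v0_closed by (intro rep_unit_unit(2)) auto
  then have step: "E i k (E k 0 v0) = E i 0 v0"
    using assms False v0_closed by (simp add: E_v0)
  have "E i k (E k 0 (E k 0 v0)) = E i 0 (E k 0 v0) \<oplus>\<^bsub>V\<^esub> E k 0 (E i k (E k 0 v0))"
    using assms False v0_closed by (intro rep_unit_unit(2)) auto
  also have "E k 0 (E i k (E k 0 v0)) = E i 0 (E k 0 v0)"
    unfolding step using assms v0_closed by (intro rep_unit_unit(1)) auto
  also have "E k 0 (E k 0 v0) = \<zero>\<^bsub>V\<^esub>" using E_lower_power_v0[of 0 k] assms by simp
  finally have "E i 0 (E k 0 v0) \<oplus>\<^bsub>V\<^esub> E i 0 (E k 0 v0) = \<zero>\<^bsub>V\<^esub>" using False by simp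
  moreover have "x \<oplus>\<^bsub>V\<^esub> x = 2 \<odot>\<^bsub>V\<^esub> x" if "x \<in> carrier V" for x
    using smult_l_distr[of 1 1 x] that by simp
  ultimately have "2 \<odot>\<^bsub>V\<^esub> E i 0 (E k 0 v0) = \<zero>\<^bsub>V\<^esub>" using assms v0_closed by simp
  then show ?thesis using smult_eq_zeroD[of 2 "E i 0 (E k 0 v0)"] assms v0_closed by simp
qed

definition e :: "nat \<Rightarrow> 'v" where
  "e k = (if k = 0 then v0 else E k 0 v0)"

lemma e_closed: "e k \<in> carrier V"
  using v0_closed by (simp add: e_def)

text \<open>The \<open>e k\<close> behave like the standard basis: move \<open>E\<^sub>i\<^sub>j\<close> past \<open>E\<^sub>k\<^sub>0\<close>, and use
  that \<open>E\<^sub>i\<^sub>j v\<^sub>0 = 0\<close> for \<open>j \<noteq> 0\<close>. For \<open>j = 0\<close> the product of two lowering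
  operators vanishes on \<open>v\<^sub>0\<close>.\<close>

lemma E_e:
  assumes "i \<le> r" "j \<le> r" "k \<le> r" "i \<noteq> j"
  shows "E i j (e k) = (if j = k then e i else \<zero>\<^bsub>V\<^esub>)"
proof (cases "k = 0 \<or> j = 0")
  case True
  then show ?thesis using assms by (auto simp: e_def E_v0 E_lower_lower_v0)
next
  case False
  then have ij: "E i j v0 = \<zero>\<^bsub>V\<^esub>" and ek: "e k = E k 0 v0" and k: "k \<noteq> 0" "j \<noteq> 0"
    using assms by (auto simp: E_v0 e_def)
  consider "j = k" "i = 0" | "j = k" "i \<noteq> 0" | "j \<noteq> k" "i = 0" | "j \<noteq> k" "i \<noteq> 0" by blast
  then show ?thesis
  proof cases
    case 1
    have "E i j (E k 0 v0) = \<rho> (diag_diff r i j) v0 \<oplus>\<^bsub>V\<^esub> E k 0 (E i j v0)"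
      using 1 assms k v0_closed by (intro rep_unit_unit(4)) auto
    then show ?thesis
      using 1 ij assms k v0_closed
      by (simp add: ek e_def v0_weight diag_diff_cartan diag_diff_index)
  next
    case 2
    have "E i j (E k 0 v0) = E i 0 v0 \<oplus>\<^bsub>V\<^esub> E k 0 (E i j v0)"
      using 2 assms k v0_closed by (intro rep_unit_unit(2)) auto
    then show ?thesis using 2 ij k v0_closed by (simp add: ek e_def)
  next
    case 3
    have "E i j (E k 0 v0) = (-1) \<odot>\<^bsub>V\<^esub> E k j v0 \<oplus>\<^bsub>V\<^esub> E k 0 (E i j v0)"
      using 3 assms k v0_closed by (intro rep_unit_unit(3)) auto
    then show ?thesis using 3 ij assms k by (simp add: ek E_v0)
  next
    case 4
    have "E i j (E k 0 v0) = E k 0 (E i j v0)"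
      using 4 assms k v0_closed by (intro rep_unit_unit(1)) auto
    then show ?thesis using 4 ij k by (simp add: ek)
  qed
qed

lemma cartan_e:
  assumes H: "H \<in> cartan r" and k: "k \<le> r"
  shows "\<rho> H (e k) = H $$ (k, k) \<odot>\<^bsub>V\<^esub> e k"
proof (cases "k = 0")
  case False
  have "\<rho> H (E k 0 v0) =
      (H $$ (k, k) - H $$ (0, 0)) \<odot>\<^bsub>V\<^esub> E k 0 v0 \<oplus>\<^bsub>V\<^esub> H $$ (0, 0) \<odot>\<^bsub>V\<^esub> E k 0 v0"
    using rep_cartan_unit[OF H k _ False v0_closed] H False v0_closed
    by (simp add: v0_weight rep_vec_smult mat_unit_in_sl[simplified])
  also have "\<dots> = H $$ (k, k) \<odot>\<^bsub>V\<^esub> E k 0 v0"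
    using smult_l_distr[of "H $$ (k, k) - H $$ (0, 0)" "H $$ (0, 0)" "E k 0 v0"] False v0_closed by simp
  finally show ?thesis using False by (simp add: e_def)
qed (simp add: e_def v0_weight H)

lemma e_nonzero: "k \<le> r \<Longrightarrow> e k \<noteq> \<zero>\<^bsub>V\<^esub>"
  using E_e[of 0 k k] v0_nonzero by (cases "k = 0") (auto simp: e_def)

text \<open>Matrix units and diagonal matrices map each \<open>e k\<close> into the span of the \<open>e k\<close>,
  hence so does every traceless matrix, and irreducibility applies.\<close>

lemma span_e: "span (e ` {..r}) = carrier V"
proof -
  let ?W = "span (e ` {..r})"
  have e_sub: "e ` {..r} \<subseteq> carrier V" using e_closed by auto
  have sub: "submodule class_ring ?W V" by (rule span_is_submodule[OF e_sub])
  note W = submodule.m_closed[OF sub] submodule.zero_closed[OF sub] submodule.smult_closed[OF sub]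
  have WV: "?W \<subseteq> carrier V" by (rule span_is_subset2[OF e_sub])
  have eW: "e k \<in> ?W" if "k \<le> r" for k using in_own_span[OF e_sub] that by blast
  have extend: "\<rho> A x \<in> ?W" if A: "A \<in> sl (r + 1)" and Ae: "\<And>k. k \<le> r \<Longrightarrow> \<rho> A (e k) \<in> ?W" and x: "x \<in> ?W"
    for A x
  proof -
    have "submodule class_ring {x \<in> carrier V. \<rho> A x \<in> ?W} V"
      using module_axioms W A
      by (intro submodule.intro) (auto simp: rep_vec_add rep_vec_smult rep_vec_zero)
    moreover have "e ` {..r} \<subseteq> {x \<in> carrier V. \<rho> A x \<in> ?W}" using Ae e_closed by auto
    ultimately have "?W \<subseteq> {x \<in> carrier V. \<rho> A x \<in> ?W}" by (rule span_is_subset[rotated])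
    then show ?thesis using x by blast
  qed
  have "\<rho> A x \<in> ?W" if "A \<in> sl (r + 1)" "x \<in> ?W" for A x
    using that
  proof (induction A rule: sl_induct)
    case (cartan H)
    have "\<rho> H (e k) \<in> ?W" if "k \<le> r" for k
      using that W(3) eW cartan by (simp add: cartan_e)
    from extend[OF cartan_in_sl[OF cartan(1)] this cartan(2)] show ?case .
  next
    case (mat_unit A i j c)
    have "E i j x \<in> ?W"
    proof (rule extend)
      show "mat_unit r i j \<in> sl (r + 1)" using mat_unit by (intro mat_unit_in_sl)
      show "E i j (e k) \<in> ?W" if "k \<le> r" for k using that mat_unit W(2) eW by (simp add: E_e)
    qed (use mat_unit in auto)
    then show ?case
      using mat_unit W WV rep_mat_add_smult[of A "mat_unit r i j" x c] mat_unit_in_sl[of i j r] by auto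
  qed
  moreover have "VectorSpace.subspace class_ring ?W V" by (rule span_is_subspace[OF e_sub])
  ultimately have "?W = {\<zero>\<^bsub>V\<^esub>} \<or> ?W = carrier V"
    using irreducible unfolding irreducible_sl_rep_def by blast
  then show ?thesis using eW[of 0] e_nonzero[of 0] by auto
qed

text \<open>The unit \<open>E\<^sub>i\<^sub>k\<close> sends a vector to its \<open>k\<close>-th coordinate times \<open>e i\<close>. Since
  \<open>E\<^sub>k\<^sub>k\<close> is not traceless, coordinates are read off with some \<open>i \<noteq> k\<close>, which exists
  as \<open>r \<ge> 1\<close>. Linearity and independence then come from the action itself.\<close>

definition partner :: "nat \<Rightarrow> nat" where "partner k = (if k = 0 then 1 else 0)"

definition coord :: "'v \<Rightarrow> nat \<Rightarrow> complex" where
  "coord x k = (THE c. E (partner k) k x = c \<odot>\<^bsub>V\<^esub> e (partner k))"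

lemma partner: "partner k \<noteq> k" "partner k \<le> r"
  using r by (auto simp: partner_def)

lemma coord_eqI:
  assumes "E (partner k) k x = c \<odot>\<^bsub>V\<^esub> e (partner k)"
  shows "coord x k = c"
  unfolding coord_def
proof (rule the_equality)
  show "E (partner k) k x = c \<odot>\<^bsub>V\<^esub> e (partner k)" by (rule assms)
  fix d assume "E (partner k) k x = d \<odot>\<^bsub>V\<^esub> e (partner k)"
  then have eq: "c \<odot>\<^bsub>V\<^esub> e (partner k) = d \<odot>\<^bsub>V\<^esub> e (partner k)" using assms by simp
  have "(c - d) \<odot>\<^bsub>V\<^esub> e (partner k) \<oplus>\<^bsub>V\<^esub> d \<odot>\<^bsub>V\<^esub> e (partner k) = c \<odot>\<^bsub>V\<^esub> e (partner k)"
    using smult_l_distr[of "c - d" d "e (partner k)"] e_closed by simp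
  then have "(c - d) \<odot>\<^bsub>V\<^esub> e (partner k) = \<zero>\<^bsub>V\<^esub>" using eq e_closed by (simp add: M.add.r_cancel_one)
  then show "d = c" using smult_eq_zeroD[OF _ e_closed] e_nonzero partner(2) by fastforce
qed

lemma E_coord:
  assumes "x \<in> carrier V" "k \<le> r"
  shows "E (partner k) k x = coord x k \<odot>\<^bsub>V\<^esub> e (partner k)"
proof -
  let ?U = "{x \<in> carrier V. \<exists>c. E (partner k) k x = c \<odot>\<^bsub>V\<^esub> e (partner k)}"
  have "submodule class_ring ?U V"
  proof (rule submodule.intro)
    show "x \<oplus>\<^bsub>V\<^esub> y \<in> ?U" if xy: "x \<in> ?U" "y \<in> ?U" for x y
    proof -
      obtain c d where *: "E (partner k) k x = c \<odot>\<^bsub>V\<^esub> e (partner k)" "E (partner k) k y = d \<odot>\<^bsub>V\<^esub> e (partner k)"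
        using xy by auto
      have "E (partner k) k (x \<oplus>\<^bsub>V\<^esub> y) = (c + d) \<odot>\<^bsub>V\<^esub> e (partner k)"
        using that * smult_l_distr[of c d] e_closed partner rep_vec_add mat_unit_in_sl by simp
      then show ?thesis using that by blast
    qed
    show "c \<odot>\<^bsub>V\<^esub> x \<in> ?U" if x: "x \<in> ?U" for c x
    proof -
      obtain d where "E (partner k) k x = d \<odot>\<^bsub>V\<^esub> e (partner k)" using x by auto
      then have "E (partner k) k (c \<odot>\<^bsub>V\<^esub> x) = (c * d) \<odot>\<^bsub>V\<^esub> e (partner k)"
        using that smult_assoc1[of c d] e_closed partner rep_vec_smult mat_unit_in_sl by simp
      then show ?thesis using that by auto
    qed
    show "\<zero>\<^bsub>V\<^esub> \<in> ?U" using partner e_closed by (auto intro!: exI[of _ 0])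
  qed (use module_axioms in auto)
  moreover have "e ` {..r} \<subseteq> ?U"
  proof -
    have "\<exists>c. E (partner k) k (e j) = c \<odot>\<^bsub>V\<^esub> e (partner k)" if "j \<le> r" for j
      using that assms partner e_closed
      by (intro exI[of _ "if k = j then 1 else 0"]) (simp add: E_e)
    then show ?thesis using e_closed by auto
  qed
  ultimately have "carrier V \<subseteq> ?U" unfolding span_e[symmetric] by (rule span_is_subset[rotated])
  then obtain c where c: "E (partner k) k x = c \<odot>\<^bsub>V\<^esub> e (partner k)" using assms by auto
  then show ?thesis using coord_eqI by simp
qed

sublocale space_with_basis V "{..r}" e coord
proof
  show "coord (x \<oplus>\<^bsub>V\<^esub> y) k = coord x k + coord y k"
    if "x \<in> carrier V" "y \<in> carrier V" "k \<in> {..r}" for x y k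
    using that smult_l_distr[of "coord x k" "coord y k"] e_closed partner
    by (intro coord_eqI) (simp add: rep_vec_add mat_unit_in_sl[simplified] E_coord)
  show "coord (c \<odot>\<^bsub>V\<^esub> x) k = c * coord x k" if "x \<in> carrier V" "k \<in> {..r}" for c x k
    using that smult_assoc1[of c "coord x k"] e_closed partner
    by (intro coord_eqI) (simp add: rep_vec_smult mat_unit_in_sl[simplified] E_coord)
  show "coord (e j) k = (if j = k then 1 else 0)" if "j \<in> {..r}" "k \<in> {..r}" for j k
    using that e_closed partner by (intro coord_eqI) (auto simp: E_e)
qed (use e_closed span_e in auto)

lemma coord_cartan:
  assumes "H \<in> cartan r" "x \<in> carrier V" "k \<in> {..r}"
  shows "coord (\<rho> H x) k = H $$ (k, k) * coord x k"
  using assms(2)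
proof (induction x rule: basis_induct)
  case (basis j)
  then show ?case using assms e_closed by (simp add: cartan_e coord_smult coord_e)
next
  case (add x y)
  then show ?case
    using assms cartan_in_sl rep_closed by (simp add: rep_vec_add coord_add algebra_simps)
next
  case (smult c x)
  then show ?case
    using assms cartan_in_sl rep_closed by (auto simp: rep_vec_smult coord_smult algebra_simps)
qed

lemma weight_mult_sym_power_first_fundamental:
  "weight_mult r (sym_power N V) (sym_action N V \<rho>) \<mu> =
    card {M. set_mset M \<subseteq> {..r} \<and> size M = N \<and> (\<forall>H\<in>cartan r. (\<Sum>k\<in>#M. H $$ (k, k)) = \<mu> H)}"
  using weight_mult_sym_power[of r \<rho> "\<lambda>H k. H $$ (k, k)" N \<mu>] coord_cartan rep_closed cartan_in_sl
  by simp

end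

section \<open>The character of a symmetric power\<close>

text \<open>The \<open>i\<close>-th coefficient, in terms of fundamental weights, of the weight of the
  monomial \<open>M\<close>: the variable \<open>k\<close> has weight \<open>\<omega>\<^sub>k\<^sub>+\<^sub>1 - \<omega>\<^sub>k\<close>.\<close>

definition weight_coeff :: "nat multiset \<Rightarrow> nat \<Rightarrow> int" where
  "weight_coeff M i = int (count M (i - 1)) - int (count M i)"

text \<open>Adding the letter \<open>k\<close> adds \<open>\<omega>\<^sub>k\<^sub>+\<^sub>1 - \<omega>\<^sub>k\<close>, which reads off the \<open>k\<close>-th
  diagonal entry. At the ends \<open>\<omega>\<^sub>0\<close> is an empty sum, and \<open>\<omega>\<^sub>r\<^sub>+\<^sub>1\<close> is the trace,
  which vanishes.\<close>

lemma weight_of_weight_coeff: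
  assumes H: "H \<in> cartan r" and M: "set_mset M \<subseteq> {..r}"
  shows "weight_of r (weight_coeff M) H = (\<Sum>k\<in>#M. H $$ (k, k))"
  using M
proof (induction M)
  case empty
  show ?case by (simp add: weight_of_def weight_coeff_def)
next
  case (add k M)
  have k: "k \<le> r" using add.prems by simp
  let ?F = "\<lambda>i. fund_weight i H"
  have "weight_of r (weight_coeff (add_mset k M)) H =
      (\<Sum>i=1..r. of_int (weight_coeff M i) * ?F i + ((if i = k + 1 then ?F i else 0) - (if i = k then ?F i else 0)))"
    unfolding weight_of_def by (rule sum.cong) (auto simp: weight_coeff_def algebra_simps)
  also have "\<dots> = weight_of r (weight_coeff M) H +
      ((if k + 1 \<in> {1..r} then ?F (k + 1) else 0) - (if k \<in> {1..r} then ?F k else 0))"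
    by (simp add: weight_of_def sum.distrib sum_subtractf)
  also have "(if k + 1 \<in> {1..r} then ?F (k + 1) else 0) - (if k \<in> {1..r} then ?F k else 0) = H $$ (k, k)"
  proof -
    have "?F (r + 1) = 0" using H by (simp add: fund_weight_def cartan_def sl_def)
    then have "(if k + 1 \<in> {1..r} then ?F (k + 1) else 0) = ?F (k + 1)" using k by (cases "k = r") auto
    moreover have "(if k \<in> {1..r} then ?F k else 0) = ?F k" using k by (cases "k = 0") (auto simp: fund_weight_def)
    ultimately show ?thesis by (simp add: fund_weight_def)
  qed
  finally show ?case using add by (simp add: algebra_simps)
qed

lemma q_monomial_weight_coeff:
  assumes "set_mset M \<subseteq> {..r}"
  shows "q_monomial r (weight_coeff M) = (\<Prod>k\<in>#M. node r k)"
  using assms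
proof (induction M)
  case empty
  show ?case by (simp add: q_monomial_def weight_coeff_def)
next
  case (add k M)
  have k: "k \<le> r" using add.prems by simp
  have "q_monomial r (weight_coeff (add_mset k M)) =
      (\<Prod>i=1..r. qvar r i powi weight_coeff M i * ((if i = k + 1 then qvar r i else 1) * (if i = k then inverse (qvar r i) else 1)))"
    unfolding q_monomial_def
  proof (rule prod.cong)
    fix i assume i: "i \<in> {1..r}"
    have "weight_coeff (add_mset k M) i = weight_coeff M i + ((if i = k + 1 then 1 else 0) + (if i = k then -1 else 0))"
      using i by (auto simp: weight_coeff_def)
    then show "qvar r i powi weight_coeff (add_mset k M) i =
        qvar r i powi weight_coeff M i * ((if i = k + 1 then qvar r i else 1) * (if i = k then inverse (qvar r i) else 1))"
      by (simp add: power_int_add power_int_minus)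
  qed simp
  also have "\<dots> = q_monomial r (weight_coeff M) *
      ((if k + 1 \<in> {1..r} then qvar r (k + 1) else 1) * (if k \<in> {1..r} then inverse (qvar r k) else 1))"
    by (simp add: q_monomial_def prod.distrib)
  also have "(if k + 1 \<in> {1..r} then qvar r (k + 1) else 1) * (if k \<in> {1..r} then inverse (qvar r k) else 1) = node r k"
    by (auto simp: node_def qvar_def divide_inverse)
  finally show ?case using add by (simp add: algebra_simps)
qed

lemma weight_of_coroot:
  assumes "i \<in> {1..r}" shows "weight_of r c (coroot r i) = of_int (c i)"
proof -
  have "weight_of r c (coroot r i) = (\<Sum>j=1..r. if i = j then of_int (c j) else 0)"
    unfolding weight_of_def using assms fund_weight_coroot by (intro sum.cong) auto
  then show ?thesis using assms by simp
qed

text \<open>The coroots form the basis dual to the fundamental weights.\<close>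

lemma weight_of_inject:
  "(\<forall>H\<in>cartan r. weight_of r c H = weight_of r d H) \<longleftrightarrow> (\<forall>i\<in>{1..r}. c i = d i)"
proof
  assume eq: "\<forall>H\<in>cartan r. weight_of r c H = weight_of r d H"
  have "c i = d i" if i: "i \<in> {1..r}" for i
    using eq coroot_in_cartan[OF i] weight_of_coroot[OF i, of c] weight_of_coroot[OF i, of d] by force
  then show "\<forall>i\<in>{1..r}. c i = d i" by blast
qed (auto simp: weight_of_def)

text \<open>If the coefficients agree, the difference of the two exponent vectors is
  constant; since the degrees agree as well, the constant is \<open>0\<close>.\<close>

lemma weight_coeff_inject:
  assumes M: "set_mset M \<subseteq> {..r}" "set_mset L \<subseteq> {..r}" and size: "size M = size L"
    and eq: "\<forall>i\<in>{1..r}. weight_coeff M i = weight_coeff L i"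
  shows "M = L"
proof -
  define d where "d k = int (count M k) - int (count L k)" for k
  have d: "d k = d 0" if "k \<le> r" for k
    using that
  proof (induction k)
    case (Suc k)
    then have "weight_coeff M (Suc k) = weight_coeff L (Suc k)" using eq by simp
    then show ?case using Suc by (simp add: d_def weight_coeff_def)
  qed simp
  have total: "(\<Sum>k\<le>r. int (count A k)) = int (size A)" if "set_mset A \<subseteq> {..r}" for A
  proof -
    have "size A = (\<Sum>k\<le>r. count A k)"
      unfolding size_multiset_overloaded_eq using that
      by (intro sum.mono_neutral_left) (auto simp: not_in_iff)
    then show ?thesis by simp
  qed
  have "(\<Sum>k\<le>r. d k) = 0"
    using total[OF M(1)] total[OF M(2)] size by (simp add: d_def sum_subtractf)
  moreover have "(\<Sum>k\<le>r. d k) = (\<Sum>k\<le>r. d 0)" by (intro sum.cong refl d) simp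
  ultimately have "d 0 = 0" by simp
  show ?thesis
  proof (rule multiset_eqI)
    fix k show "count M k = count L k"
    proof (cases "k \<le> r")
      case True
      then show ?thesis using d[of k] \<open>d 0 = 0\<close> by (simp add: d_def)
    next
      case False
      then have "k \<notin># M" "k \<notin># L" using M by auto
      then show ?thesis by (simp add: not_in_iff)
    qed
  qed
qed

text \<open>The monomials of degree \<open>N\<close> correspond bijectively to the weights of \<open>S\<^sup>NV\<close>,
  each of multiplicity one, and the exponential of a monomial weight is the product
  of the nodes.\<close>

lemma (in first_fundamental) character_sym_power:
  "character r (sym_power N V) (sym_action N V \<rho>) = complete_homogeneous (node r) N {0..r}"
proof -
  let ?Mons = "{M. set_mset M \<subseteq> {..r} \<and> size M = N}"
  define coeffs where "coeffs M = restrict (weight_coeff M) {1..r}" for M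
  define m where "m c = weight_mult r (sym_power N V) (sym_action N V \<rho>) (weight_of r c)" for c
  have inj: "inj_on coeffs ?Mons"
  proof (rule inj_onI)
    fix M L assume *: "M \<in> ?Mons" "L \<in> ?Mons" "coeffs M = coeffs L"
    have "weight_coeff M i = weight_coeff L i" if "i \<in> {1..r}" for i
      using fun_cong[OF *(3), of i] that by (simp add: coeffs_def)
    then show "M = L" using * by (intro weight_coeff_inject) auto
  qed
  have m: "m c = card {M \<in> ?Mons. coeffs M = c}" if c: "c \<in> {1..r} \<rightarrow>\<^sub>E UNIV" for c
  proof -
    have "(\<forall>H\<in>cartan r. (\<Sum>k\<in>#M. H $$ (k, k)) = weight_of r c H) \<longleftrightarrow> coeffs M = c" if M: "M \<in> ?Mons" for M
    proof -
      have "(\<forall>H\<in>cartan r. (\<Sum>k\<in>#M. H $$ (k, k)) = weight_of r c H) \<longleftrightarrow>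
          (\<forall>H\<in>cartan r. weight_of r (weight_coeff M) H = weight_of r c H)"
        using M weight_of_weight_coeff by simp
      also have "\<dots> \<longleftrightarrow> (\<forall>i\<in>{1..r}. weight_coeff M i = c i)" by (rule weight_of_inject)
      also have "\<dots> \<longleftrightarrow> coeffs M = c"
        using c by (auto simp: coeffs_def fun_eq_iff PiE_def extensional_def)
      finally show ?thesis .
    qed
    then show ?thesis
      unfolding m_def weight_mult_sym_power_first_fundamental
      by (intro arg_cong[of _ _ card]) auto
  qed
  have m_coeffs: "m (coeffs M) = 1" if M: "M \<in> ?Mons" for M
  proof -
    have "{L \<in> ?Mons. coeffs L = coeffs M} = {M}" using M inj by (auto dest: inj_onD)
    moreover have "coeffs M \<in> {1..r} \<rightarrow>\<^sub>E UNIV" by (simp add: coeffs_def)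
    ultimately show ?thesis by (simp add: m)
  qed
  have support: "{c. c \<in> {1..r} \<rightarrow>\<^sub>E UNIV \<and> m c \<noteq> 0} = coeffs ` ?Mons"
  proof (intro equalityI subsetI)
    fix c assume "c \<in> {c. c \<in> {1..r} \<rightarrow>\<^sub>E UNIV \<and> m c \<noteq> 0}"
    then have "card {M \<in> ?Mons. coeffs M = c} \<noteq> 0" using m by auto
    then have "{M \<in> ?Mons. coeffs M = c} \<noteq> {}" by (metis card.empty)
    then show "c \<in> coeffs ` ?Mons" by auto
  next
    fix c assume "c \<in> coeffs ` ?Mons"
    then show "c \<in> {c. c \<in> {1..r} \<rightarrow>\<^sub>E UNIV \<and> m c \<noteq> 0}"
      using m_coeffs by (auto simp: coeffs_def)
  qed
  have "character r (sym_power N V) (sym_action N V \<rho>) = (\<Sum>c\<in>coeffs ` ?Mons. of_nat (m c) * q_monomial r c)"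
    unfolding character_def m_def[symmetric] support ..
  also have "\<dots> = (\<Sum>M\<in>?Mons. of_nat (m (coeffs M)) * q_monomial r (coeffs M))"
    by (simp add: sum.reindex[OF inj])
  also have "\<dots> = (\<Sum>M\<in>?Mons. \<Prod>k\<in>#M. node r k)"
  proof (rule sum.cong)
    fix M assume M: "M \<in> ?Mons"
    have "q_monomial r (coeffs M) = q_monomial r (weight_coeff M)"
      by (auto simp: q_monomial_def coeffs_def intro!: prod.cong)
    then show "of_nat (m (coeffs M)) * q_monomial r (coeffs M) = (\<Prod>k\<in>#M. node r k)"
      using M m_coeffs[OF M] q_monomial_weight_coeff by simp
  qed simp
  finally show ?thesis by (simp add: complete_homogeneous_def atLeast0AtMost)
qed

lemma first_fundamental_of_highest_weight:
  assumes "r \<ge> 1" and hw: "irreducible_highest_weight_rep r (fund_weight 1) V \<rho>"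
  shows "\<exists>v0. first_fundamental V r \<rho> v0"
proof -
  have rep: "sl_rep r V \<rho>" and irr: "irreducible_sl_rep r V \<rho>"
    using hw by (auto simp: irreducible_highest_weight_rep_def irreducible_sl_rep_def)
  obtain v where v: "v \<in> weight_space r V \<rho> (fund_weight 1)" "v \<noteq> \<zero>\<^bsub>V\<^esub>"
    "\<forall>A\<in>strictly_upper r. \<rho> A v = \<zero>\<^bsub>V\<^esub>"
    using hw by (auto simp: irreducible_highest_weight_rep_def)
  interpret vectorspace class_ring V using rep by (simp add: sl_rep_def)
  have "first_fundamental V r \<rho> v"
    by unfold_locales (use assms rep irr v in \<open>auto simp: weight_space_def fund_weight_def\<close>)
  then show ?thesis ..
qed

theorem corollary3p9:
  fixes r :: nat
    and V :: "(complex, 'v) module"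
    and \<rho> :: "complex mat \<Rightarrow> 'v \<Rightarrow> 'v"
  assumes "r \<ge> 1"
    and "irreducible_highest_weight_rep r (fund_weight 1) V \<rho>"
  shows "(\<forall>i\<in>{0..r}. A_coeff r i \<in> rat_funs r) \<and>
    (\<forall>N::nat. character r (sym_power N V) (sym_action N V \<rho>) =
       (\<Sum>i=0..r. qvar r i powi (- int N) * qvar r (i + 1) ^ N * A_coeff r i))"
proof -
  obtain v0 where "first_fundamental V r \<rho> v0"
    using first_fundamental_of_highest_weight[OF assms] by blast
  then show ?thesis
    by (simp add: A_coeff_in_rat_funs first_fundamental.character_sym_power complete_homogeneous_node
        del: of_nat_Suc Suc_eq_plus1)
qed

end
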